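(* Let $p_k$ denote the $k$th prime and, for real $\alpha>0$ and $n\in\mathbb{Z}^+$, let $S_n^{(\alpha)}=\sum_{k=1}^n p_k^{\alpha}$. Let $\alpha\geqslant 1$ and let $n$ be a positive integer with $n\geqslant \max\{100,\ e^{2\times 1.348^{\alpha}+1}\}$. Then $$\sqrt[n]{\frac{S_n^{(\alpha)}}{n}}>\sqrt[n+1]{\frac{S_{n+1}^{(\alpha)}}{n+1}}$$ and hence $$\sqrt[n]{S_n^{(\alpha)}}>\sqrt[n+1]{S_{n+1}^{(\alpha)}}.$$
   Context: $p_k$ is the $k$th prime ($p_1=2$), and $S_n^{(\alpha)}=\sum_{k=1}^n p_k^{\alpha}$. *)

theory Defs
  imports "HOL-Analysis.Analysis" "HOL-Computational_Algebra.Primes" "HOL-Library.Infinite_Set"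
begin

text \<open>The k-th prime, 1-indexed: nth_prime 1 = 2.\<close>
definition nth_prime :: "nat \<Rightarrow> nat" where
  "nth_prime k = enumerate {p::nat. prime p} (k - 1)"

definition S :: "real \<Rightarrow> nat \<Rightarrow> real" where
  "S \<alpha> n = (\<Sum>k=1..n. real (nth_prime k) powr \<alpha>)"

end

theory Submission
  imports Defs "HOL-Number_Theory.Prime_Powers" "HOL-Analysis.Harmonic_Numbers"
begin

text \<open>
  Let $x = p_{n+1}$ and $A = S_n^{(\alpha)}/n$. Since passing from $n$ to $n+1$ multiplies $A$ by
  $1 + (x^\alpha/A - 1)/(n+1)$, the claim follows from $x^\alpha/A \le 1 + \ln A$. If
  $p_k \ge (x/\kappa)(k/n)^{1+\varepsilon}$ for $n/2 < k \le n$, then comparing the sum with an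
  integral bounds $x^\alpha/A$ by essentially $((1+\varepsilon)\alpha+1)\kappa^\alpha$, while
  $\ln A \ge \alpha(2 \cdot 1.348^\alpha + 1)$ roughly; so any $\kappa$ that tends to a limit below
  $1.348$ is good enough for large $n$. Chebyshev's method gives
  $\psi(x) \ge 0.9212\,x - O(\ln x)$ and $\psi(x) \le 1.1057\,x + O(\ln^2 x)$, whose ratio
  $1.2003$ leaves sufficient room for all $n \ge 1000$; smaller $n$ are settled by an explicit sieve.
\<close>

subsection \<open>Chebyshev's estimates\<close>

text \<open>The hypothesis ties \<alpha> to \<open>n\<close>: a large \<alpha> forces
  \<open>ln n\<close> to grow like 1.348^\<alpha>, while a small \<alpha> admits small
  \<open>n\<close>. The available \<kappa> is 1.2222 times the ratio of the upper bound for
  \<open>ln x\<close> to \<open>ln n + 0.7\<close>. It tends to 1.2222 * 12/11 < 1.3334, but only at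
  the rate 1/\<open>ln n\<close>, and at \<open>n = 1000\<close> it is still 1.486. So comparing
  powers of \<kappa> with powers of 1.348 works only for large \<alpha>. Below \<alpha> = 27/2 the
  range of \<alpha> is cut into intervals, each with its own lower bound for \<open>ln n\<close> and
  its own \<kappa>; convexity then leaves two numerical inequalities per interval. The two bounds
  for primes come from \<open>psi\<close> in different ways. The upper bound for \<open>x\<close>
  follows by counting, from psi(x) <= pi(x) ln x. For a lower bound on p_k, passing from
  \<open>psi\<close> to pi would need partial summation. This is avoided by bounding the sum of ln
  p_j over j <= k by psi(p_k), and by feeding the resulting bound on p_{k+1} back into that sum. The
  start of this induction at k = 500 is a second use of the sieve.\<close>

definition psi :: "nat \<Rightarrow> real" where
  "psi n = (\<Sum>d\<in>{1..n}. mangoldt d)"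

definition theta :: "nat \<Rightarrow> real" where
  "theta n = (\<Sum>p | prime p \<and> p \<le> n. ln (real p))"

lemma psi_mono: "m \<le> n \<Longrightarrow> psi m \<le> psi n"
  unfolding psi_def by (intro sum_mono2) (auto simp: mangoldt_nonneg)

lemma theta_le_psi: "theta n \<le> psi n"
proof -
  have "theta n = (\<Sum>p | prime p \<and> p \<le> n. mangoldt p)"
    unfolding theta_def by (intro sum.cong) auto
  also have "\<dots> \<le> psi n"
    unfolding psi_def
    by (intro sum_mono2) (auto simp: mangoldt_nonneg Suc_le_eq prime_gt_0_nat)
  finally show ?thesis .
qed

text \<open>Prime powers are grouped by their prime: a prime p has at most ln n / ln p powers up to
  n, each contributing ln p, so its group contributes at most ln n.\<close>

lemma psi_le_card_primes_ln:
  assumes "n \<ge> 1"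
  shows "psi n \<le> card {p. prime p \<and> p \<le> n} * ln n"
proof -
  let ?P = "{p. prime p \<and> p \<le> n}"
  let ?Q = "{d\<in>{1..n}. primepow d}"
  have finP: "finite ?P" by (rule finite_subset[of _ "{..n}"]) auto
  have sub: "aprimedivisor ` ?Q \<subseteq> ?P"
  proof safe
    fix d assume d: "d \<in> {1..n}" "primepow d"
    show "prime (aprimedivisor d)" using d by (intro prime_aprimedivisor') (auto dest: primepow_gt_Suc_0)
    have "aprimedivisor d dvd d" using d by (intro aprimedivisor_dvd') (auto dest: primepow_gt_Suc_0)
    thus "aprimedivisor d \<le> n" using d dvd_imp_le[of "aprimedivisor d" d] by simp
  qed
  have "psi n = (\<Sum>d\<in>?Q. ln (real (aprimedivisor d)))"
    unfolding psi_def by (intro sum.mono_neutral_cong_right) (auto simp: mangoldt_def)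
  also have "\<dots> = (\<Sum>p\<in>?P. \<Sum>d | d \<in> ?Q \<and> aprimedivisor d = p. ln (real (aprimedivisor d)))"
    using finP sub by (intro sum.group[symmetric]) auto
  also have "\<dots> \<le> (\<Sum>p\<in>?P. ln n)"
  proof (rule sum_mono)
    fix p assume p: "p \<in> ?P"
    let ?R = "{d. d \<in> ?Q \<and> aprimedivisor d = p}"
    let ?m = "nat \<lfloor>ln n / ln p\<rfloor>"
    have p1: "real p > 1" using p prime_gt_1_nat[of p] by simp
    hence lnp: "ln (real p) > 0" by simp
    have "?R \<subseteq> (\<lambda>k. p ^ k) ` {1..?m}"
    proof
      fix d assume d: "d \<in> ?R"
      then obtain q k where qk: "prime q" "k > 0" "d = q ^ k" by (auto simp: primepow_def)
      with d have "q = p" by (auto simp: aprimedivisor_prime_power)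
      with qk have dk: "d = p ^ k" by simp
      have "real p ^ k \<le> real n" using d dk by (simp flip: of_nat_power)
      hence "ln (real p ^ k) \<le> ln (real n)" using p1 assms by (subst ln_le_cancel_iff) auto
      hence "k * ln p \<le> ln n" using p1 by (simp add: ln_realpow)
      hence "real k \<le> ln n / ln p" using lnp by (simp add: field_simps)
      hence "k \<le> ?m" by (simp add: le_nat_floor)
      with qk(2) show "d \<in> (\<lambda>k. p ^ k) ` {1..?m}" unfolding dk by auto
    qed
    hence "card ?R \<le> card {1..?m}" by (rule surj_card_le[rotated]) auto
    hence "card ?R \<le> ?m" by simp
    hence "real (card ?R) \<le> real ?m" by simp
    also have "real ?m \<le> ln n / ln p" using p1 lnp assms by (intro of_nat_floor divide_nonneg_pos) auto
    finally have "card ?R * ln p \<le> ln n" using lnp by (simp add: field_simps)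
    thus "(\<Sum>d\<in>?R. ln (real (aprimedivisor d))) \<le> ln n" by simp
  qed
  also have "\<dots> = card ?P * ln n" by simp
  finally show ?thesis .
qed

text \<open>Each ln m is the sum of \<open>mangoldt\<close> over the divisors of m, and the order of
  summation is swapped. Terms with d > n vanish; the free bound \<open>N\<close> lets the five
  factorials in \<open>cheb\<close> share one range of summation.\<close>

lemma ln_fact_eq_sum_mangoldt:
  assumes "n \<le> N"
  shows "ln (fact n) = (\<Sum>d\<in>{1..N}. mangoldt d * real (n div d))"
proof -
  have "ln (fact n) = (\<Sum>m\<in>{1..n}. ln (real m))"
    unfolding fact_prod by (simp, subst ln_prod) auto
  also have "\<dots> = (\<Sum>m\<in>{1..n}. \<Sum>d | d dvd m. mangoldt d)"
    by (intro sum.cong refl) (subst mangoldt_sum, auto)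
  also have "\<dots> = (\<Sum>m\<in>{1..n}. \<Sum>d\<in>{1..N}. if d dvd m then mangoldt d else 0)"
  proof (rule sum.cong[OF refl])
    fix m assume m: "m \<in> {1..n}"
    have *: "{d. d dvd m} = {d\<in>{1..N}. d dvd m}"
      using m assms by (auto dest: dvd_imp_le intro: Suc_leI Nat.gr0I)
    show "(\<Sum>d | d dvd m. mangoldt d :: real) = (\<Sum>d\<in>{1..N}. if d dvd m then mangoldt d else 0)"
      unfolding * by (rule sum.inter_filter) simp
  qed
  also have "\<dots> = (\<Sum>d\<in>{1..N}. \<Sum>m\<in>{1..n}. if d dvd m then mangoldt d else 0)"
    by (rule sum.swap)
  also have "\<dots> = (\<Sum>d\<in>{1..N}. mangoldt d * real (n div d))"
  proof (intro sum.cong refl)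
    fix d assume d: "d \<in> {1..N}"
    have "{m\<in>{1..n}. d dvd m} = (\<lambda>k. d * k) ` {1..n div d}"
      using d by (auto simp: div_le_mono less_eq_div_iff_mult_less_eq mult.commute elim!: dvdE)
    hence "card {m\<in>{1..n}. d dvd m} = n div d"
      using d by (simp add: card_image inj_on_def)
    thus "(\<Sum>m\<in>{1..n}. if d dvd m then mangoldt d else 0 :: real) = mangoldt d * real (n div d)"
      by (simp flip: sum.inter_filter)
  qed
  finally show ?thesis .
qed

text \<open>The logarithm of Chebyshev's quotient n! (n/30)! / ((n/2)! (n/3)! (n/5)!) with floors.
  As 1 - 1/2 - 1/3 - 1/5 + 1/30 = 0, the n ln n terms of Stirling's formula cancel and linear growth
  remains.\<close>

definition cheb :: "nat \<Rightarrow> real" where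
  "cheb n = ln (fact n) - ln (fact (n div 2)) - ln (fact (n div 3)) - ln (fact (n div 5))
     + ln (fact (n div 30))"

text \<open>The coefficients 30, -15, -10, -6, 1 sum to 0, so the combination depends only on m mod
  30, and the thirty residues are checked.\<close>

lemma chebyshev_floor_combination:
  fixes m :: nat
  defines "f \<equiv> int m - int (m div 2) - int (m div 3) - int (m div 5) + int (m div 30)"
  shows "f \<ge> 0" "f \<le> 1" "1 \<le> m \<Longrightarrow> m < 6 \<Longrightarrow> f = 1"
proof -
  define q r where "q = m div 30" and "r = m mod 30"
  have m: "m = 30 * q + r" "r < 30" by (simp_all add: q_def r_def)
  have "m div 2 = 15 * q + r div 2" "m div 3 = 10 * q + r div 3" "m div 5 = 6 * q + r div 5"
       "m div 30 = q" unfolding m(1) using m(2) by linarith+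
  hence f: "f = int r - int (r div 2) - int (r div 3) - int (r div 5)"
    by (simp add: f_def m(1))
  have "\<forall>r\<in>set [0..<30]. int r - int (r div 2) - int (r div 3) - int (r div 5) \<in> {0, 1}"
    by (simp add: upt_rec)
  with m(2) have "f \<in> {0, 1}" by (simp add: f)
  thus "f \<ge> 0" "f \<le> 1" by auto
  assume "1 \<le> m" "m < 6"
  hence "m \<in> {1,2,3,4,5}" by auto
  thus "f = 1" by (auto simp: f_def)
qed

text \<open>\<open>cheb n\<close> is the sum of \<open>mangoldt d\<close> weighted by the floor
  combination at \<open>n div d\<close>. The weights lie in {0, 1} and equal 1 when
  \<open>n div d\<close> is in 1..5, that is, for d > n div 6.\<close>

lemma cheb_le_psi: "cheb n \<le> psi n"
  and psi_le_psi_div_6_plus_cheb: "psi n \<le> psi (n div 6) + cheb n"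
proof -
  define f where "f = (\<lambda>m. int m - int (m div 2) - int (m div 3) - int (m div 5) + int (m div 30))"
  have "cheb n = (\<Sum>d\<in>{1..n}. mangoldt d * real (n div d)) - (\<Sum>d\<in>{1..n}. mangoldt d * real (n div 2 div d))
      - (\<Sum>d\<in>{1..n}. mangoldt d * real (n div 3 div d)) - (\<Sum>d\<in>{1..n}. mangoldt d * real (n div 5 div d))
      + (\<Sum>d\<in>{1..n}. mangoldt d * real (n div 30 div d))"
    unfolding cheb_def by (intro arg_cong2[where f = "(-)"] arg_cong2[where f = "(+)"] ln_fact_eq_sum_mangoldt) auto
  also have "\<dots> = (\<Sum>d\<in>{1..n}. mangoldt d * real_of_int (f (n div d)))"
    unfolding sum_subtractf[symmetric] sum.distrib[symmetric]
    by (intro sum.cong refl) (simp add: f_def algebra_simps div_mult2_eq[symmetric] mult.commute)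
  finally have cheb: "cheb n = (\<Sum>d\<in>{1..n}. mangoldt d * real_of_int (f (n div d)))" .
  have f: "f m \<ge> 0" "f m \<le> 1" "1 \<le> m \<Longrightarrow> m < 6 \<Longrightarrow> f m = 1" for m
    using chebyshev_floor_combination[of m] by (simp_all add: f_def)
  have "cheb n \<le> (\<Sum>d\<in>{1..n}. mangoldt d * 1)"
    unfolding cheb by (intro sum_mono mult_left_mono mangoldt_nonneg) (use f(2) in auto)
  thus "cheb n \<le> psi n" by (simp add: psi_def)
  have "psi n - psi (n div 6) = (\<Sum>d\<in>{n div 6<..n}. mangoldt d)"
  proof -
    have *: "{1..n} = {1..n div 6} \<union> {n div 6<..n}" by auto
    show ?thesis unfolding psi_def by (subst *, subst sum.union_disjoint) auto
  qed
  also have "\<dots> = (\<Sum>d\<in>{n div 6<..n}. mangoldt d * real_of_int (f (n div d)))"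
  proof (intro sum.cong refl)
    fix d assume d: "d \<in> {n div 6<..n}"
    hence "d > 0" by auto
    have "n div d < 6" "1 \<le> n div d"
      using d \<open>d > 0\<close> by (auto simp: div_less_iff_less_mult less_eq_div_iff_mult_less_eq)
    thus "mangoldt d = mangoldt d * real_of_int (f (n div d))" using f(3) by simp
  qed
  also have "\<dots> \<le> cheb n" unfolding cheb
    using f(1) by (intro sum_mono2) (auto simp: mangoldt_nonneg)
  finally show "psi n \<le> psi (n div 6) + cheb n" by simp
qed

section \<open>Stirling bounds for factorials\<close>

lemma ln_Suc_minus_ln_bounds:
  fixes x :: real
  assumes "x > 0"
  shows "2 \<le> (2 * x + 1) * (ln (x + 1) - ln x)"
    and "(2 * x + 1) * (ln (x + 1) - ln x) \<le> 2 + 1 / (2 * x) - 1 / (2 * (x + 1))"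
proof -
  \<comment> \<open>The midpoint rule and, further down, the trapezoidal rule for the integral of
    the convex function 1/t.\<close>
  have "ln (x + 1) - ln x \<ge> 2 / (2 * x + 1)"
    using ln_inverse_approx_ge[of x "x + 1"] assms by (simp add: algebra_simps)
  thus "2 \<le> (2 * x + 1) * (ln (x + 1) - ln x)"
    using assms by (subst (asm) pos_divide_le_eq) (auto simp: mult.commute)
  have "ln (x + 1) - ln x \<le> (inverse x + inverse (x + 1)) / 2"
    using ln_inverse_approx_le[of x 1] assms by simp
  hence "(2 * x + 1) * (ln (x + 1) - ln x) \<le> (2 * x + 1) * ((inverse x + inverse (x + 1)) / 2)"
    using assms by (intro mult_left_mono) auto
  also have "\<dots> = 2 + 1 / (2 * x) - 1 / (2 * (x + 1))"
    using assms by (simp add: divide_simps) (simp add: algebra_simps)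
  finally show "(2 * x + 1) * (ln (x + 1) - ln x) \<le> 2 + 1 / (2 * x) - 1 / (2 * (x + 1))" .
qed

lemma ln_fact_upper:
  assumes "m \<ge> 1"
  shows "ln (fact m) \<le> m * ln m - m + ln m / 2 + 1"
  using assms
proof (induction m rule: nat_induct_at_least)
  case (Suc m)
  have "ln (fact (Suc m)) = ln (real m + 1) + ln (fact m)"
    by (simp add: ln_mult add.commute)
  thus ?case using Suc ln_Suc_minus_ln_bounds(1)[of "real m"] by (simp add: algebra_simps)
qed simp

text \<open>The term 1/(4m) carries the induction: its decrease from m to m + 1 is exactly half the
  excess of the trapezoidal bound. The constant 3/4 gives equality at m = 1.\<close>

lemma ln_fact_lower:
  assumes "m \<ge> 1"
  shows "m * ln m - m + ln m / 2 + 3 / 4 + 1 / (4 * real m) \<le> ln (fact m)"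
  using assms
proof (induction m rule: nat_induct_at_least)
  case (Suc m)
  define a b where "a = 1 / (2 * real m)" and "b = 1 / (2 * (real m + 1))"
  have ab: "1 / (4 * real m) = a / 2" "1 / (4 * (real m + 1)) = b / 2"
    by (simp_all add: a_def b_def)
  have "(2 * real m + 1) * (ln (real m + 1) - ln m) \<le> 2 + a - b"
    using ln_Suc_minus_ln_bounds(2)[of "real m"] Suc.hyps by (simp add: a_def b_def)
  with Suc.IH have "(real m + 1) * ln (real m + 1) - (real m + 1) + ln (real m + 1) / 2 + 3 / 4
      + 1 / (4 * (real m + 1)) \<le> ln (real m + 1) + ln (fact m)"
    unfolding ab by (simp add: algebra_simps)
  also have "\<dots> = ln (fact (Suc m))" by (simp add: ln_mult add.commute)
  finally show ?case by (simp add: add.commute)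
qed simp

lemma x_ln_x_increment:
  fixes a b :: real
  assumes "0 < a" "a \<le> b"
  shows "b * ln b - b \<le> a * ln a - a + (b - a) * ln b"
    and "a * ln a - a + (b - a) * ln a \<le> b * ln b - b"
proof -
  have "ln b - ln a \<le> b / a - 1"
    using assms ln_le_minus_one[of "b / a"] by (simp add: ln_div)
  hence "a * (ln b - ln a) \<le> a * (b / a - 1)" using assms by (intro mult_left_mono) auto
  also have "\<dots> = b - a" using assms by (simp add: field_simps)
  finally show "b * ln b - b \<le> a * ln a - a + (b - a) * ln b" by (simp add: algebra_simps)
  have "ln a - ln b \<le> a / b - 1"
    using assms ln_le_minus_one[of "a / b"] by (simp add: ln_div)
  hence "b * (ln a - ln b) \<le> b * (a / b - 1)" using assms by (intro mult_left_mono) auto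
  also have "\<dots> = a - b" using assms by (simp add: field_simps)
  finally show "a * ln a - a + (b - a) * ln a \<le> b * ln b - b" by (simp add: algebra_simps)
qed

text \<open>Replacing m = \<open>n div j\<close> by the real quotient y, which exceeds m by at most
  1, costs nothing above. Below, it costs ln y in x ln x - x and 1/2 in ln m / 2, which turns + ln y
  / 2 into - ln y / 2 and 3/4 into 1/4.\<close>

lemma ln_fact_div_bounds:
  fixes n j :: nat
  defines "y \<equiv> real n / real j"
  assumes "1 \<le> j" "j \<le> n"
  shows "ln (fact (n div j)) \<le> y * ln y - y + ln y / 2 + 1"
    and "y * ln y - y - ln y / 2 + 1 / 4 \<le> ln (fact (n div j))"
proof -
  define m where "m = n div j"
  have m1: "m \<ge> 1" using assms by (simp add: m_def less_eq_div_iff_mult_less_eq)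
  have my: "real m \<le> y" "y \<le> real m + 1"
  proof -
    have "real (m * j) \<le> real n" by (subst of_nat_le_iff) (simp add: m_def)
    thus "real m \<le> y" using assms by (simp add: y_def field_simps)
    have "n < (m + 1) * j" using assms by (simp add: m_def dividend_less_div_times)
    hence "real n \<le> real ((m + 1) * j)" by (subst of_nat_le_iff) simp
    thus "y \<le> real m + 1" using assms by (simp add: y_def field_simps)
  qed
  have y1: "y \<ge> 1" using m1 my by simp
  have lnm: "0 \<le> ln m" "ln m \<le> ln y" using m1 my by auto
  have "0 \<le> (y - m) * ln m" using lnm my by simp
  thus "ln (fact (n div j)) \<le> y * ln y - y + ln y / 2 + 1"
    using x_ln_x_increment(2)[of m y] ln_fact_upper[OF m1] my m1 lnm
    unfolding m_def[symmetric] by linarith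
  have "ln (y / m) \<le> y / m - 1" using my m1 by (intro ln_le_minus_one) auto
  also have "y / m - 1 \<le> 1" using my m1 by (simp add: field_simps)
  finally have "ln y - ln m \<le> 1" using my m1 by (simp add: ln_div)
  moreover have "(y - m) * ln y \<le> 1 * ln y" using my lnm by (intro mult_right_mono) auto
  moreover have "1 / (4 * real m) \<ge> 0" by simp
  ultimately show "y * ln y - y - ln y / 2 + 1 / 4 \<le> ln (fact (n div j))"
    using x_ln_x_increment(1)[of m y] ln_fact_lower[OF m1] my m1
    unfolding m_def[symmetric] by linarith
qed

text \<open>The coefficient of n left by the terms y ln y at y = n/j, j = 1, 2, 3, 5, 30, once the n
  ln n parts cancel.\<close>

definition cheb_const :: real where
  "cheb_const = ln 2 / 2 + ln 3 / 3 + ln 5 / 5 - ln 30 / 30"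

lemma cheb_bounds:
  assumes "n \<ge> 30"
  shows "cheb n \<le> cheb_const * n + 5 / 2 * ln n - ln 30 + 5 / 4"
    and "cheb_const * n - 3 / 2 * ln n + ln 30 - 2 \<le> cheb n"
proof -
  have n: "real n > 0" using assms by simp
  have l30: "ln (30::real) = ln 2 + ln 3 + ln 5"
    using ln_mult[of 2 "15::real"] ln_mult[of 3 "5::real"] by simp
  have l: "ln (real n / j) = ln n - ln j" if "j > 0" for j :: real
    using n that by (simp add: ln_div)
  note b = ln_fact_div_bounds[of 1 n] ln_fact_div_bounds[of 2 n] ln_fact_div_bounds[of 3 n]
    ln_fact_div_bounds[of 5 n] ln_fact_div_bounds[of 30 n]
  \<comment> \<open>For j = 1 there is no floor to pay for, so Stirling's bound itself gives + ln n
    / 2. This keeps the final coefficient at -3/2.\<close>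
  have lo1: "n * ln n - n + ln n / 2 + 3 / 4 \<le> ln (fact n)"
  proof -
    have "1 / (4 * real n) \<ge> 0" by simp
    thus ?thesis using ln_fact_lower[of n] assms by linarith
  qed
  show "cheb n \<le> cheb_const * n + 5 / 2 * ln n - ln 30 + 5 / 4"
    unfolding cheb_def cheb_const_def
    using b(1) b(4) b(6) b(8) b(9) assms by (simp add: l l30 field_simps)
  show "cheb_const * n - 3 / 2 * ln n + ln 30 - 2 \<le> cheb n"
    unfolding cheb_def cheb_const_def
    using lo1 b(3) b(5) b(7) b(10) assms by (simp add: l l30 field_simps)
qed

section \<open>Numerical bounds for logarithms\<close>

lemma ln_2_bounds: "(69314 / 100000) \<le> ln (2::real)" "ln (2::real) \<le> 69315 / 100000"
  using ln_approx_bounds[of 2 5] by (simp_all add: eval_nat_numeral)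

lemma ln_3_bounds: "(109860 / 100000) \<le> ln (3::real)" "ln (3::real) \<le> 109863 / 100000"
proof -
  have "ln (3::real) = ln 2 + ln (3 / 2)" by (simp add: ln_div)
  moreover have "(40546 / 100000) \<le> ln (3 / 2 :: real)" "ln (3 / 2 :: real) \<le> 40547 / 100000"
    using ln_approx_bounds[of "3 / 2" 4] by (simp_all add: eval_nat_numeral)
  ultimately show "(109860 / 100000) \<le> ln (3::real)" "ln (3::real) \<le> 109863 / 100000"
    using ln_2_bounds by simp_all
qed

lemma ln_5_bounds: "(160942 / 100000) \<le> ln (5::real)" "ln (5::real) \<le> 160946 / 100000"
proof -
  have "ln (5::real) = ln 4 + ln (5 / 4)" by (simp add: ln_div)
  moreover have "ln (4::real) = 2 * ln 2" using ln_realpow[of 2 2] by simp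
  moreover have "(22314 / 100000) \<le> ln (5 / 4 :: real)" "ln (5 / 4 :: real) \<le> 22315 / 100000"
    using ln_approx_bounds[of "5 / 4" 3] by (simp_all add: eval_nat_numeral)
  ultimately show "(160942 / 100000) \<le> ln (5::real)" "ln (5::real) \<le> 160946 / 100000"
    using ln_2_bounds by simp_all
qed

lemma ln_6: "ln (6::real) = ln 2 + ln 3"
  using ln_mult[of 2 "3::real"] by simp

lemma ln_30: "ln (30::real) = ln 2 + ln 3 + ln 5"
  using ln_mult[of 2 "15::real"] ln_mult[of 3 "5::real"] by simp

lemma cheb_const_bounds: "(9212 / 10000) \<le> cheb_const" "cheb_const \<le> 9214 / 10000"
proof -
  have "cheb_const = 7 / 15 * ln 2 + 3 / 10 * ln 3 + 1 / 6 * ln 5"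
    unfolding cheb_const_def ln_30 by (simp add: field_simps)
  thus "(9212 / 10000) \<le> cheb_const" "cheb_const \<le> 9214 / 10000"
    using ln_2_bounds ln_3_bounds ln_5_bounds by linarith+
qed

text \<open>Numbers whose logarithm is to be estimated are rounded to nearby 5-smooth ones, so the
  bounds for ln 2, ln 3 and ln 5 suffice.\<close>

lemma ln_5_smooth: "ln ((2::real) ^ a * 3 ^ b * 5 ^ c) = a * ln 2 + b * ln 3 + c * ln 5"
  by (simp add: ln_mult ln_realpow)

lemma mangoldt_eq_0:
  assumes "prime p" "prime q" "p \<noteq> q" "p dvd n" "q dvd (n::nat)"
  shows "mangoldt n = (0::real)"
  using assms aprimedivisor_primepow(2)[of p n] aprimedivisor_primepow(2)[of q n]
  by (auto simp: mangoldt_def)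

text \<open>These start the recursion n -> n div 6, since \<open>cheb_bounds\<close> is available
  only from n = 30 on. The logarithms of the primes from 7 on are rounded up to 5-smooth
  arguments.\<close>

lemma psi_12: "psi 12 \<le> 11" and psi_29: "psi 29 \<le> 292 / 10"
proof -
  have pr: "prime (2::nat)" "prime (3::nat)" "prime (5::nat)" "prime (7::nat)" "prime (11::nat)"
      "prime (13::nat)" "prime (17::nat)" "prime (19::nat)" "prime (23::nat)" "prime (29::nat)"
    by simp_all
  have z: "mangoldt n = (0::real)" if "n \<in> {6, 10, 12, 14, 15, 18, 20, 21, 22, 24, 26, 28}" for n :: nat
  proof -
    from that have "2 dvd n \<and> (3 dvd n \<or> 5 dvd n \<or> 7 dvd n \<or> 11 dvd n \<or> 13 dvd n) \<or> 3 dvd n \<and> (5 dvd n \<or> 7 dvd n)"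
      by auto
    moreover have ne: "(2::nat) \<noteq> 3" "(2::nat) \<noteq> 5" "(2::nat) \<noteq> 7" "(2::nat) \<noteq> 11" "(2::nat) \<noteq> 13"
        "(3::nat) \<noteq> 5" "(3::nat) \<noteq> 7" by simp_all
    ultimately show ?thesis
      using mangoldt_eq_0[OF pr(1,2) ne(1), of n] mangoldt_eq_0[OF pr(1,3) ne(2), of n] mangoldt_eq_0[OF pr(1,4) ne(3), of n]
        mangoldt_eq_0[OF pr(1,5) ne(4), of n] mangoldt_eq_0[OF pr(1,6) ne(5), of n] mangoldt_eq_0[OF pr(2,3) ne(6), of n]
        mangoldt_eq_0[OF pr(2,4) ne(7), of n]
      by blast
  qed
  have q: "mangoldt 4 = ln (2::real)" "mangoldt 8 = ln (2::real)" "mangoldt 16 = ln (2::real)"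
      "mangoldt 9 = ln (3::real)" "mangoldt 27 = ln (3::real)" "mangoldt 25 = ln (5::real)"
    using pr(1,2,3)[THEN mangoldt_primepow'[where k = 2 and 'a = real]]
      pr(1,2)[THEN mangoldt_primepow'[where k = 3 and 'a = real]]
      pr(1)[THEN mangoldt_primepow'[where k = 4 and 'a = real]]
    by simp_all
  note p = pr[THEN mangoldt_prime[where 'a = real]]
  have l: "ln (7::real) \<le> ln 8" "ln (11::real) \<le> ln 12" "ln (13::real) \<le> ln (27 / 2)" "ln (17::real) \<le> ln 18"
      "ln (19::real) \<le> ln 20" "ln (23::real) \<le> ln 24" "ln (29::real) \<le> ln 30"
    by simp_all
  have l': "ln (8::real) = 3 * ln 2" "ln (12::real) = 2 * ln 2 + ln 3"
      "ln (27 / 2::real) = 3 * ln 3 - ln 2" "ln (18::real) = ln 2 + 2 * ln 3"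
      "ln (20::real) = 2 * ln 2 + ln 5" "ln (24::real) = 3 * ln 2 + ln 3"
    using ln_5_smooth[of 3 0 0] ln_5_smooth[of 2 1 0] ln_5_smooth[of 1 2 0] ln_5_smooth[of 2 0 1]
      ln_5_smooth[of 3 1 0] ln_5_smooth[of 0 3 0] ln_div[of 27 "2::real"] by simp_all
  have psi: "psi n = sum_list (map mangoldt [1..<Suc n])" for n
    by (simp only: psi_def interv_sum_list_conv_sum_set_nat set_upt atLeastLessThanSuc_atLeastAtMost)
  have u12: "[1..<Suc 12] = [1, 2, 3, 4, 5, 6, 7, 8, 9, 10, 11, 12]" by (simp add: upt_rec)
  have "psi 12 = 3 * ln 2 + 2 * ln 3 + ln 5 + ln 7 + ln 11"
    unfolding psi u12 by (simp del: mangoldt_prime add: z q p)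
  thus "psi 12 \<le> 11"
    using l l' ln_2_bounds ln_3_bounds ln_5_bounds by linarith
  have u29: "[1..<Suc 29] = [1, 2, 3, 4, 5, 6, 7, 8, 9, 10, 11, 12, 13, 14, 15, 16, 17, 18, 19, 20, 21, 22, 23, 24, 25, 26, 27, 28, 29]" by (simp add: upt_rec)
  have "psi 29 = 4 * ln 2 + 3 * ln 3 + 2 * ln 5 + ln 7 + ln 11 + ln 13 + ln 17 + ln 19 + ln 23 + ln 29"
    unfolding psi u29 by (simp del: mangoldt_prime add: z q p)
  thus "psi 29 \<le> 292 / 10"
    using l l' ln_30 ln_2_bounds ln_3_bounds ln_5_bounds by linarith
qed

text \<open>
  The coefficient of $\ln^2 n$ has to exceed $5/(4 \ln 6)$, so that the recursion
  $n \mapsto n/6$ absorbs the error term $\frac{5}{2} \ln n$.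
\<close>

lemma psi_upper:
  assumes "n \<ge> 1"
  shows "psi n \<le> 11057 / 10000 * n + 72 / 100 * (ln n)\<^sup>2 + 11"
  using assms
proof (induction n rule: less_induct)
  case (less n)
  have l6: "(179174 / 100000) \<le> ln (6::real)" "ln (6::real) \<le> 179178 / 100000"
    using ln_6 ln_2_bounds ln_3_bounds by linarith+
  consider "n \<le> 12" | "13 \<le> n" "n \<le> 29" | "n \<ge> 30" by linarith
  thus ?case
  proof cases
    case 1
    hence "psi n \<le> 11" using psi_mono[of n 12] psi_12 by simp
    thus ?thesis by (rule order.trans) simp
  next
    case 2
    have "ln (12::real) = 2 * ln 2 + ln 3" using ln_5_smooth[of 2 1 0] by simp
    hence "(248 / 100) \<le> ln (12::real)" using ln_2_bounds ln_3_bounds by linarith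
    also have "\<dots> \<le> ln n" using 2 by simp
    finally have "(248 / 100)\<^sup>2 \<le> (ln n)\<^sup>2" by (intro power_mono) auto
    moreover have "psi n \<le> 292 / 10" using psi_mono[of n 29] psi_29 2 by simp
    ultimately show ?thesis using 2 by (simp add: power2_eq_square)
  next
    case 3
    define m where "m = n div 6"
    have m: "1 \<le> m" "m < n" using 3 by (auto simp: m_def)
    have mn: "real m \<le> n / 6" unfolding m_def by linarith
    have "ln m \<le> ln (n / 6)" using mn m by (subst ln_le_cancel_iff) auto
    hence lm: "ln m \<le> ln n - ln 6" using 3 by (simp add: ln_div)
    have "ln m \<ge> 0" using m by simp
    with lm have "(ln m)\<^sup>2 \<le> (ln n - ln 6)\<^sup>2" by (intro power_mono)
    also have "\<dots> = (ln n)\<^sup>2 - 2 * ln 6 * ln n + (ln 6)\<^sup>2" by (simp add: power2_diff)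
    finally have sq: "(ln m)\<^sup>2 \<le> (ln n)\<^sup>2 - 2 * ln 6 * ln n + (ln 6)\<^sup>2" .
    have "(ln 6)\<^sup>2 \<le> (179178 / 100000::real)\<^sup>2" using l6 by (intro power_mono) auto
    also have "\<dots> \<le> 32105 / 10000" by (simp add: power2_eq_square)
    finally have l6s: "(ln 6)\<^sup>2 \<le> (32105 / 10000 :: real)" .
    have l30: "ln 30 \<le> ln n" using 3 by simp
    have l30': "ln (30::real) \<ge> 34 / 10"
      using ln_30 ln_2_bounds ln_3_bounds ln_5_bounds by linarith
    have "179174 / 100000 * ln n \<le> ln 6 * ln n" using l6 l30 l30' by (intro mult_right_mono) auto
    hence "72 / 100 * (ln m)\<^sup>2 + 5 / 2 * ln n - ln 30 + 5 / 4 \<le> 72 / 100 * (ln n)\<^sup>2"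
      using sq l6s l30 l30' by argo
    moreover have "psi m \<le> 11057 / 10000 * m + 72 / 100 * (ln m)\<^sup>2 + 11" using less.IH[of m] m by simp
    \<comment> \<open>The constant 1.1057 is just above 6/5 * 0.9214, the fixed point of c = c/6 +
      0.9214.\<close>
    moreover have "cheb_const * n \<le> 9214 / 10000 * n" using cheb_const_bounds by (intro mult_right_mono) auto
    ultimately show ?thesis
      using psi_le_psi_div_6_plus_cheb[of n] cheb_bounds(1)[OF 3] mn
      unfolding m_def[symmetric] by simp
  qed
qed

lemma ln_3424_le: "ln (3424::real) \<le> 8148 / 1000"
proof -
  have "ln (3424::real) \<le> ln 3456" by simp
  also have "\<dots> = 7 * ln 2 + 3 * ln 3" using ln_5_smooth[of 7 3 0] by simp
  finally show ?thesis using ln_2_bounds ln_3_bounds by linarith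
qed

text \<open>3424 = 6.848 * 500 is the lower bound for the 500th prime that the sieve gives. From
  there on (ln n)^2 grows at most linearly, because ln t <= 2 (sqrt t - 1) and 2 <= 8.148; hence n =
  3424 is the worst case and determines 1.123.\<close>

lemma psi_le:
  assumes "n \<ge> 3424"
  shows "psi n \<le> 1123 / 1000 * n"
proof -
  define t where "t = real n / 3424"
  have t: "t \<ge> 1" "real n = 3424 * t" using assms by (simp_all add: t_def)
  have "ln (sqrt t) \<le> sqrt t - 1" using t by (intro ln_le_minus_one) auto
  hence "ln t \<le> 2 * (sqrt t - 1)" using t by (simp add: ln_sqrt)
  hence "ln n \<le> (8148 / 1000) + 2 * (sqrt t - 1)" using t ln_3424_le by (simp add: ln_mult)
  also have "\<dots> \<le> 8148 / 1000 * sqrt t" using t by simp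
  finally have "(ln n)\<^sup>2 \<le> (8148 / 1000 * sqrt t)\<^sup>2" using assms by (intro power_mono) auto
  also have "\<dots> = (8148 / 1000)\<^sup>2 * t" using t by (simp only: power_mult_distrib) simp
  finally have "(ln n)\<^sup>2 \<le> 6640 / 100 * t" using t by (simp add: power2_eq_square)
  with psi_upper[of n] assms t show ?thesis by simp
qed

text \<open>The error 3/2 ln n from \<open>cheb_bounds\<close> is kept as one and a half extra
  primes; ln 30 - 2 >= 0 is dropped.\<close>

lemma card_primes_ge:
  fixes n :: nat
  assumes "n \<ge> 30"
  shows "9212 / 10000 * n \<le> (card {p. prime p \<and> p \<le> n} + 3 / 2) * ln n"
proof -
  have "9212 / 10000 * n \<le> cheb_const * n" using cheb_const_bounds by (intro mult_right_mono) auto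
  moreover have "ln (30::real) \<ge> 2" using ln_30 ln_2_bounds ln_3_bounds ln_5_bounds by linarith
  ultimately show ?thesis
    using cheb_bounds(2)[OF assms] cheb_le_psi[of n] psi_le_card_primes_ln[of n] assms
    unfolding ring_distribs by linarith
qed

subsection \<open>The primes below 7921\<close>

lemma prime_nth_prime: "prime (nth_prime k)"
  using enumerate_in_set[OF primes_infinite] by (simp add: nth_prime_def)

lemma nth_prime_less: "1 \<le> j \<Longrightarrow> j < k \<Longrightarrow> nth_prime j < nth_prime k"
  unfolding nth_prime_def by (intro enumerate_mono primes_infinite) auto

lemma nth_prime_mono: "1 \<le> j \<Longrightarrow> j \<le> k \<Longrightarrow> nth_prime j \<le> nth_prime k"
  using nth_prime_less[of j k] by (cases "j = k") auto

lemma inj_on_nth_prime: "inj_on nth_prime {1..k}"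
  by (rule strict_mono_on_imp_inj_on) (auto intro!: strict_mono_onI nth_prime_less)

lemma prime_eq_nth_prime:
  assumes "prime p"
  obtains k where "k \<ge> 1" "p = nth_prime k"
proof -
  obtain i where "enumerate {p::nat. prime p} i = p"
    using enumerate_Ex[of "{p::nat. prime p}" p] assms primes_infinite by auto
  thus ?thesis by (intro that[of "Suc i"]) (auto simp: nth_prime_def)
qed

lemma primes_le_nth_prime:
  assumes "k \<ge> 1"
  shows "{p. prime p \<and> p \<le> nth_prime k} = nth_prime ` {1..k}"
proof (intro equalityI subsetI)
  fix p assume p: "p \<in> {p. prime p \<and> p \<le> nth_prime k}"
  then obtain j where j: "j \<ge> 1" "p = nth_prime j" using prime_eq_nth_prime by auto
  with p nth_prime_less[of k j] assms have "j \<le> k" by (cases "j \<le> k") auto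
  with j show "p \<in> nth_prime ` {1..k}" by auto
qed (auto simp: prime_nth_prime intro: nth_prime_mono)

lemma card_primes_le_nth_prime: "k \<ge> 1 \<Longrightarrow> card {p. prime p \<and> p \<le> nth_prime k} = k"
  by (simp add: primes_le_nth_prime card_image inj_on_nth_prime del: One_nat_def)

lemma theta_nth_prime: "k \<ge> 1 \<Longrightarrow> theta (nth_prime k) = (\<Sum>j\<in>{1..k}. ln (real (nth_prime j)))"
  by (simp add: theta_def primes_le_nth_prime sum.reindex inj_on_nth_prime del: One_nat_def)

lemma primes_less_Suc_if: "{q::nat. prime q \<and> q < Suc m} =
    (if prime m then insert m {q. prime q \<and> q < m} else {q. prime q \<and> q < m})"
  by (auto simp: less_Suc_eq)

lemma nth_prime_Suc_card:
  assumes "prime p"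
  shows "nth_prime (Suc (card {q. prime q \<and> q < p})) = p"
proof -
  obtain k where k: "k \<ge> 1" "p = nth_prime k" using prime_eq_nth_prime[OF assms] .
  have "k = card {q. prime q \<and> q < Suc p}"
    using card_primes_le_nth_prime[OF k(1)] k(2) by (simp add: less_Suc_eq_le)
  also have "\<dots> = Suc (card {q. prime q \<and> q < p})"
    using assms by (simp add: primes_less_Suc_if)
  finally show ?thesis using k by simp
qed

section \<open>Primality by trial division\<close>

fun trial_division :: "nat list \<Rightarrow> nat \<Rightarrow> bool" where
  "trial_division [] m = True"
| "trial_division (q # qs) m =
     (if m < q * q then True else if m mod q = 0 then False else trial_division qs m)"

text \<open>2 is left out because only odd numbers are tested. The next prime is 97, so the list
  decides primality below 97 * 97 = 9409, well past the 1000th prime 7919.\<close>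

definition small_primes :: "nat list" where
  "small_primes = [3, 5, 7, 11, 13, 17, 19, 23, 29, 31, 37, 41, 43, 47, 53, 59, 61, 67, 71, 73, 79, 83, 89]"

lemma trial_division_iff:
  "sorted qs \<Longrightarrow> trial_division qs m \<longleftrightarrow> (\<forall>q\<in>set qs. q * q \<le> m \<longrightarrow> \<not> q dvd m)"
proof (induction qs)
  case (Cons q qs)
  show ?case
  proof (cases "m < q * q")
    case True
    have "m < r * r" if "r \<in> set qs" for r
      using True mult_le_mono[of q r q r] Cons.prems that by fastforce
    with True show ?thesis by fastforce
  next
    case False
    thus ?thesis using Cons by (auto simp: dvd_eq_mod_eq_0)
  qed
qed simp

text \<open>Below 97 < 11 * 11 every composite number is divisible by 2, 3, 5 or 7, so four
  remainders per number suffice.\<close>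

lemma small_prime_cases:
  assumes "prime q" "q < 97"
  shows "q = 2 \<or> q \<in> set small_primes"
proof -
  have *: "\<forall>q\<in>set [2..<97]. q \<in> set (2 # small_primes) \<or> q mod 2 = 0 \<or> q mod 3 = 0 \<or> q mod 5 = 0 \<or> q mod 7 = 0"
    by (simp add: upt_rec small_primes_def)
  have "q \<in> set [2..<97]"
    using prime_ge_2_nat[OF assms(1)] assms(2) by (simp only: set_upt atLeastLessThan_iff)
  from bspec[OF * this] have "q \<in> set (2 # small_primes) \<or> 2 dvd q \<or> 3 dvd q \<or> 5 dvd q \<or> 7 dvd q"
    by (simp only: dvd_eq_mod_eq_0)
  hence "q \<in> set (2 # small_primes) \<or> q \<in> {2, 3, 5, 7}"
    using assms(1) unfolding prime_nat_iff by (elim disjE) auto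
  thus ?thesis by (auto simp: small_primes_def)
qed

lemma trial_division_small_primes_iff:
  assumes "odd m" "3 \<le> m" "m < 97 * 97"
  shows "trial_division small_primes m \<longleftrightarrow> prime m"
proof -
  have small: "q \<ge> 2" if "q \<in> set small_primes" for q
    using that by (auto simp: small_primes_def)
  have "sorted small_primes" by (simp add: small_primes_def)
  hence iff: "trial_division small_primes m \<longleftrightarrow> (\<forall>q\<in>set small_primes. q * q \<le> m \<longrightarrow> \<not> q dvd m)"
    by (rule trial_division_iff)
  show ?thesis unfolding iff
  proof
    assume "prime m"
    have False if "q \<in> set small_primes" "q * q \<le> m" "q dvd m" for q
    proof -
      from \<open>prime m\<close> \<open>q dvd m\<close> small[OF that(1)] have "q = m" by (auto simp: prime_nat_iff)
      with \<open>q * q \<le> m\<close> assms(2) show False by simp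
    qed
    thus "\<forall>q\<in>set small_primes. q * q \<le> m \<longrightarrow> \<not> q dvd m" by blast
  next
    assume *: "\<forall>q\<in>set small_primes. q * q \<le> m \<longrightarrow> \<not> q dvd m"
    show "prime m"
    proof (rule ccontr)
      assume "\<not> prime m"
      obtain a where a: "a dvd m" "a \<noteq> 1" "a \<noteq> m"
        using \<open>\<not> prime m\<close> assms(2) by (auto simp: prime_nat_iff)
      define b where "b = m div a"
      have ab: "m = a * b" using a by (simp add: b_def)
      have "min a b * min a b \<le> a * b" by (intro mult_mono) auto
      hence "min a b * min a b \<le> m" using ab by simp
      moreover have "min a b \<noteq> 1" using a ab by (auto simp: min_def)
      ultimately obtain d where d: "d dvd m" "d \<noteq> 1" "d * d \<le> m"
        using ab by (metis dvd_triv_left dvd_triv_right min_def)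
      obtain q where q: "prime q" "q dvd d" using prime_factor_nat[OF d(2)] by blast
      have "d > 0" using d assms by (auto intro!: Nat.gr0I)
      hence "q \<le> d" using q by (intro dvd_imp_le)
      hence qq: "q * q \<le> m" using d(3) mult_le_mono[of q d q d] by linarith
      have "q < 97"
      proof (rule ccontr)
        assume "\<not> q < 97"
        hence "97 * 97 \<le> q * q" by (intro mult_le_mono) auto
        with qq assms(3) show False by simp
      qed
      moreover have "q dvd m" using q d by (meson dvd_trans)
      moreover have "q \<noteq> 2" using \<open>q dvd m\<close> assms(1) by auto
      ultimately show False using * qq small_prime_cases[OF q(1)] by blast
    qed
  qed
qed

text \<open>
  The number \<open>m\<close> runs through odd numbers up to the odd number \<open>b\<close>, and \<open>c\<close> is the number
  of primes below \<open>m\<close>; \<open>d\<close> and \<open>e\<close> bound $p_k/k$ from below and $p_k/(k-1)$ from above in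
  units of $1/1000$, and \<open>r\<close> is the expected number of primes below \<open>b\<close>.
\<close>

function scan :: "nat \<Rightarrow> nat \<Rightarrow> nat \<Rightarrow> nat \<Rightarrow> nat \<Rightarrow> nat \<Rightarrow> bool" where
  "scan d e b r m c =
    (if b \<le> m then c = r
     else if trial_division small_primes m
     then d * (c + 1) \<le> 1000 * m \<and> 1000 * m \<le> e * c \<and> scan d e b r (m + 2) (c + 1)
     else scan d e b r (m + 2) c)"
  by auto
termination by (relation "Wellfounded.measure (\<lambda>(d, e, b, r, m, c). b - m)") auto

declare scan.simps [simp del]

text \<open>The invariant is that \<open>c\<close> counts the primes below \<open>m\<close>: a prime
  \<open>m\<close> is then the prime of index c + 1, and the skipped m + 1 is even. The upper bound
  has k - 1 because it is applied at k = n + 1 and compared with n.\<close>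

lemma scan_sound:
  assumes "scan d e b r m c" "odd m" "odd b" "3 \<le> m" "m \<le> b" "b < 97 * 97"
    and "card {q. prime q \<and> q < m} = c"
  shows "card {q. prime q \<and> q < b} = r \<and>
    (\<forall>k. c < k \<and> k \<le> r \<longrightarrow> d * k \<le> 1000 * nth_prime k \<and> 1000 * nth_prime k \<le> e * (k - 1))"
  using assms
proof (induction d e b r m c rule: scan.induct)
  case (1 d e b r m c)
  note IH = "1.IH" and sc = "1.prems"(1) and odd = "1.prems"(2,3) and le = "1.prems"(4-6)
    and card = "1.prems"(7)
  show ?case
  proof (cases "b \<le> m")
    case True
    with le have "b = m" by simp
    with sc card show ?thesis by (simp add: scan.simps[of d e m r m c])
  next
    case False
    have fin: "finite {q::nat. prime q \<and> q < m}" by simp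
    have m2: "odd (m + 2)" "m + 2 \<le> b" "3 \<le> m + 2" using odd le False by presburger+
    have np: "\<not> prime (Suc m)" using odd le prime_odd_nat[of "Suc m"] by auto
    have trial: "trial_division small_primes m \<longleftrightarrow> prime m"
      using odd le False by (intro trial_division_small_primes_iff) auto
    show ?thesis
    proof (cases "prime m")
      case True
      have card': "card {q. prime q \<and> q < m + 2} = c + 1"
        using card np fin True by (simp add: primes_less_Suc_if)
      have rest: "scan d e b r (m + 2) (c + 1)" "d * (c + 1) \<le> 1000 * m" "1000 * m \<le> e * c"
        using sc False True trial by (simp_all add: scan.simps[of d e b r m c])
      have IH: "card {q. prime q \<and> q < b} = r \<and>
        (\<forall>k. c + 1 < k \<and> k \<le> r \<longrightarrow> d * k \<le> 1000 * nth_prime k \<and> 1000 * nth_prime k \<le> e * (k - 1))"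
        using trial True False by (intro IH(1) rest m2 odd le card') auto
      have m: "nth_prime (c + 1) = m" using nth_prime_Suc_card[OF True] card by simp
      show ?thesis
      proof (intro conjI allI impI)
        fix k assume "c < k \<and> k \<le> r"
        hence "k = c + 1 \<or> c + 1 < k \<and> k \<le> r" by auto
        thus "d * k \<le> 1000 * nth_prime k" "1000 * nth_prime k \<le> e * (k - 1)"
          using IH rest m by auto
      qed (use IH in simp)
    next
      case False2: False
      have card': "card {q. prime q \<and> q < m + 2} = c"
        using card np fin False2 by (simp add: primes_less_Suc_if)
      have rest: "scan d e b r (m + 2) c"
        using sc False False2 trial by (simp add: scan.simps[of d e b r m c])
      show ?thesis
        using trial False False2 by (intro IH(2) rest m2 odd le card') auto
    qed
  qed
qed

text \<open>A minimal rule set for evaluation on binary numerals. With \<open>if_weak_cong\<close>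
  the branches of a conditional wait for its test, so the unfolding of \<open>scan.simps\<close>
  stays finite.\<close>

lemmas scan_eval = scan.simps trial_division.simps small_primes_def arith_simps rel_simps
  arith_special if_True if_False simp_thms mult_1_right numeral_mod_numeral[where ?'a = nat]
  divmod_trivial[where ?'a = nat] divmod_cancel[where ?'a = nat] divmod_steps[where ?'a = nat]
  divmod_step_def[where ?'a = nat] fst_conv snd_conv prod.case mult_zero_right euclidean_size_nat_less_eq_iff
  diff_nat_numeral nat_numeral nat_zero_as_int[symmetric] nat_one_as_int[symmetric]

text \<open>Each scan treats one block of indices and stops two past the last prime of the block.
  \<open>d\<close> is the largest integer that passes on its block, except that the last block
  repeats 6848. Early blocks are short because p_k / k grows fastest there.\<close>

lemma scan_20: "scan 1500 6650 73 20 3 1"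
  by (simp only: scan_eval cong: if_weak_cong)

lemma scan_50: "scan 3476 6650 231 50 73 20"
  by (simp only: scan_eval cong: if_weak_cong)

lemma scan_100: "scan 4547 6650 543 100 231 50"
  by (simp only: scan_eval cong: if_weak_cong)

lemma scan_150: "scan 5415 6650 865 150 543 100"
  by (simp only: scan_eval cong: if_weak_cong)

lemma scan_200: "scan 5759 6650 1225 200 865 150"
  by (simp only: scan_eval cong: if_weak_cong)

lemma scan_300: "scan 6093 6650 1989 300 1225 200"
  by (simp only: scan_eval cong: if_weak_cong)

lemma scan_400: "scan 6587 7940 2743 400 1989 300"
  by (simp only: scan_eval cong: if_weak_cong)

lemma scan_700: "scan 6848 7940 5281 700 2743 400"
  by (simp only: scan_eval cong: if_weak_cong)

lemma scan_1000: "scan 6848 7940 7921 1000 5281 700"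
  by (simp only: scan_eval cong: if_weak_cong)

lemma card_primes_less_3: "card {q::nat. prime q \<and> q < 3} = 1"
proof -
  have "{q::nat. prime q \<and> q < 3} = {2}"
  proof (intro equalityI subsetI)
    fix q :: nat assume "q \<in> {q. prime q \<and> q < 3}"
    with prime_ge_2_nat[of q] show "q \<in> {2}" by simp
  qed auto
  thus ?thesis by simp
qed

lemmas scan_card = conjunct1[OF scan_sound]
lemmas scan_lower = conjunct1[OF conjunct2[OF scan_sound, rule_format, OF _ _ _ _ _ _ _ conjI]]
lemmas scan_upper = conjunct2[OF conjunct2[OF scan_sound, rule_format, OF _ _ _ _ _ _ _ conjI]]

lemma card_primes_less_73: "card {q::nat. prime q \<and> q < 73} = 20"
  by (rule scan_card[OF scan_20 _ _ _ _ _ card_primes_less_3]) simp_all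

lemma card_primes_less_231: "card {q::nat. prime q \<and> q < 231} = 50"
  by (rule scan_card[OF scan_50 _ _ _ _ _ card_primes_less_73]) simp_all

lemma card_primes_less_543: "card {q::nat. prime q \<and> q < 543} = 100"
  by (rule scan_card[OF scan_100 _ _ _ _ _ card_primes_less_231]) simp_all

lemma card_primes_less_865: "card {q::nat. prime q \<and> q < 865} = 150"
  by (rule scan_card[OF scan_150 _ _ _ _ _ card_primes_less_543]) simp_all

lemma card_primes_less_1225: "card {q::nat. prime q \<and> q < 1225} = 200"
  by (rule scan_card[OF scan_200 _ _ _ _ _ card_primes_less_865]) simp_all

lemma card_primes_less_1989: "card {q::nat. prime q \<and> q < 1989} = 300"
  by (rule scan_card[OF scan_300 _ _ _ _ _ card_primes_less_1225]) simp_all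

lemma card_primes_less_2743: "card {q::nat. prime q \<and> q < 2743} = 400"
  by (rule scan_card[OF scan_400 _ _ _ _ _ card_primes_less_1989]) simp_all

lemma card_primes_less_5281: "card {q::nat. prime q \<and> q < 5281} = 700"
  by (rule scan_card[OF scan_700 _ _ _ _ _ card_primes_less_2743]) simp_all

section \<open>Tables for the first 1000 primes\<close>

lemma nth_prime_lower_table:
  "1 < k \<Longrightarrow> k \<le> 20 \<Longrightarrow> 1500 * k \<le> 1000 * nth_prime k"
  "20 < k \<Longrightarrow> k \<le> 50 \<Longrightarrow> 3476 * k \<le> 1000 * nth_prime k"
  "50 < k \<Longrightarrow> k \<le> 100 \<Longrightarrow> 4547 * k \<le> 1000 * nth_prime k"
  "100 < k \<Longrightarrow> k \<le> 150 \<Longrightarrow> 5415 * k \<le> 1000 * nth_prime k"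
  "150 < k \<Longrightarrow> k \<le> 200 \<Longrightarrow> 5759 * k \<le> 1000 * nth_prime k"
  "200 < k \<Longrightarrow> k \<le> 300 \<Longrightarrow> 6093 * k \<le> 1000 * nth_prime k"
  "300 < k \<Longrightarrow> k \<le> 400 \<Longrightarrow> 6587 * k \<le> 1000 * nth_prime k"
  "400 < k \<Longrightarrow> k \<le> 700 \<Longrightarrow> 6848 * k \<le> 1000 * nth_prime k"
  "700 < k \<Longrightarrow> k \<le> 1000 \<Longrightarrow> 6848 * k \<le> 1000 * nth_prime k"
  by ((rule scan_lower[OF scan_20 _ _ _ _ _ card_primes_less_3]; simp),
      (rule scan_lower[OF scan_50 _ _ _ _ _ card_primes_less_73]; simp),
      (rule scan_lower[OF scan_100 _ _ _ _ _ card_primes_less_231]; simp),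
      (rule scan_lower[OF scan_150 _ _ _ _ _ card_primes_less_543]; simp),
      (rule scan_lower[OF scan_200 _ _ _ _ _ card_primes_less_865]; simp),
      (rule scan_lower[OF scan_300 _ _ _ _ _ card_primes_less_1225]; simp),
      (rule scan_lower[OF scan_400 _ _ _ _ _ card_primes_less_1989]; simp),
      (rule scan_lower[OF scan_700 _ _ _ _ _ card_primes_less_2743]; simp),
      (rule scan_lower[OF scan_1000 _ _ _ _ _ card_primes_less_5281]; simp))

lemma nth_prime_upper_table:
  "100 < k \<Longrightarrow> k \<le> 150 \<Longrightarrow> 1000 * nth_prime k \<le> 6650 * (k - 1)"
  "150 < k \<Longrightarrow> k \<le> 200 \<Longrightarrow> 1000 * nth_prime k \<le> 6650 * (k - 1)"
  "200 < k \<Longrightarrow> k \<le> 300 \<Longrightarrow> 1000 * nth_prime k \<le> 6650 * (k - 1)"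
  "300 < k \<Longrightarrow> k \<le> 400 \<Longrightarrow> 1000 * nth_prime k \<le> 7940 * (k - 1)"
  "400 < k \<Longrightarrow> k \<le> 700 \<Longrightarrow> 1000 * nth_prime k \<le> 7940 * (k - 1)"
  "700 < k \<Longrightarrow> k \<le> 1000 \<Longrightarrow> 1000 * nth_prime k \<le> 7940 * (k - 1)"
  by ((rule scan_upper[OF scan_150 _ _ _ _ _ card_primes_less_543]; simp),
      (rule scan_upper[OF scan_200 _ _ _ _ _ card_primes_less_865]; simp),
      (rule scan_upper[OF scan_300 _ _ _ _ _ card_primes_less_1225]; simp),
      (rule scan_upper[OF scan_400 _ _ _ _ _ card_primes_less_1989]; simp),
      (rule scan_upper[OF scan_700 _ _ _ _ _ card_primes_less_2743]; simp),
      (rule scan_upper[OF scan_1000 _ _ _ _ _ card_primes_less_5281]; simp))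

lemma nth_prime_le_6650:
  assumes "100 < k" "k \<le> 300"
  shows "1000 * nth_prime k \<le> 6650 * (k - 1)"
proof -
  consider "k \<le> 150" | "150 < k" "k \<le> 200" | "200 < k" using assms by linarith
  thus ?thesis by cases (use assms nth_prime_upper_table(1-3)[of k] in blast)+
qed

lemma nth_prime_le_7940:
  assumes "300 < k" "k \<le> 1000"
  shows "1000 * nth_prime k \<le> 7940 * (k - 1)"
proof -
  consider "k \<le> 400" | "400 < k" "k \<le> 700" | "700 < k" using assms by linarith
  thus ?thesis by cases (use assms nth_prime_upper_table(4-6)[of k] in blast)+
qed

lemma nth_prime_ge_4547:
  assumes "50 < k" "k \<le> 1000"
  shows "4547 * k \<le> 1000 * nth_prime k"
proof -
  consider "50 < k" "k \<le> 100" | "100 < k" "k \<le> 150" | "150 < k" "k \<le> 200" | "200 < k" "k \<le> 300" | "300 < k" "k \<le> 400" | "400 < k" "k \<le> 700" | "700 < k" "k \<le> 1000" using assms by linarith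
  thus ?thesis
  proof cases
    case 1
    with nth_prime_lower_table(3)[of k] show ?thesis by linarith
  next
    case 2
    with nth_prime_lower_table(4)[of k] show ?thesis by linarith
  next
    case 3
    with nth_prime_lower_table(5)[of k] show ?thesis by linarith
  next
    case 4
    with nth_prime_lower_table(6)[of k] show ?thesis by linarith
  next
    case 5
    with nth_prime_lower_table(7)[of k] show ?thesis by linarith
  next
    case 6
    with nth_prime_lower_table(8)[of k] show ?thesis by linarith
  next
    case 7
    with nth_prime_lower_table(9)[of k] show ?thesis by linarith
  qed
qed

lemma nth_prime_ge_5759:
  assumes "150 < k" "k \<le> 1000"
  shows "5759 * k \<le> 1000 * nth_prime k"
proof -
  consider "150 < k" "k \<le> 200" | "200 < k" "k \<le> 300" | "300 < k" "k \<le> 400" | "400 < k" "k \<le> 700" | "700 < k" "k \<le> 1000" using assms by linarith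
  thus ?thesis
  proof cases
    case 1
    with nth_prime_lower_table(5)[of k] show ?thesis by linarith
  next
    case 2
    with nth_prime_lower_table(6)[of k] show ?thesis by linarith
  next
    case 3
    with nth_prime_lower_table(7)[of k] show ?thesis by linarith
  next
    case 4
    with nth_prime_lower_table(8)[of k] show ?thesis by linarith
  next
    case 5
    with nth_prime_lower_table(9)[of k] show ?thesis by linarith
  qed
qed

lemma ln_nth_prime_minus_ln_ge:
  assumes "d * k \<le> 1000 * nth_prime k" "k \<ge> 1" "v \<le> ln (d / 1000)" "d > 0"
  shows "v \<le> ln (nth_prime k) - ln k"
proof -
  have "real (d * k) \<le> real (1000 * nth_prime k)" using assms(1) by (subst of_nat_le_iff)
  hence "d / 1000 \<le> nth_prime k / k" using assms by (simp add: field_simps)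
  hence "ln (d / 1000) \<le> ln (nth_prime k / k)"
    using assms by (intro ln_mono) auto
  also have "\<dots> = ln (nth_prime k) - ln k"
    using assms prime_gt_0_nat[OF prime_nth_prime[of k]] by (simp add: ln_div)
  finally show ?thesis using assms by simp
qed

lemma sum_atLeastAtMost_extend:
  fixes f :: "nat \<Rightarrow> real"
  assumes "a \<le> b" "s \<le> (\<Sum>j\<in>{1..a}. f j)" "\<And>j. a < j \<Longrightarrow> j \<le> b \<Longrightarrow> v \<le> f j"
  shows "s + (real b - real a) * v \<le> (\<Sum>j\<in>{1..b}. f j)"
proof -
  have *: "{1..b} = {1..a} \<union> {a<..b}" using assms(1) by auto
  have "(\<Sum>j\<in>{1..b}. f j) = (\<Sum>j\<in>{1..a}. f j) + (\<Sum>j\<in>{a<..b}. f j)"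
    unfolding * by (rule sum.union_disjoint) auto
  moreover have "real (card {a<..b}) * v \<le> (\<Sum>j\<in>{a<..b}. f j)"
    using assms(3) by (intro sum_bounded_below) auto
  ultimately show ?thesis using assms(1,2) by (simp add: of_nat_diff)
qed

text \<open>The base of the induction in \<open>sum_ln_nth_prime_ge\<close>. Summing ln p_j - ln j
  block by block gives at least 850.3 > 500 * 1.7, and Stirling's bound for ln(500!) takes 500
  away.\<close>

lemma sum_ln_nth_prime_500: "500 * (ln 500 + 7 / 10) \<le> (\<Sum>j\<in>{1..500}. ln (nth_prime j))"
proof -
  define f where "f = (\<lambda>j. ln (nth_prime j) - ln j)"
  note lb = ln_2_bounds ln_3_bounds ln_5_bounds
  have v: "4 / 10 \<le> ln (1500 / 1000 :: real)" "124 / 100 \<le> ln (3476 / 1000 :: real)"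
    "15 / 10 \<le> ln (4547 / 1000 :: real)" "168 / 100 \<le> ln (5415 / 1000 :: real)"
    "173 / 100 \<le> ln (5759 / 1000 :: real)" "18 / 10 \<le> ln (6093 / 1000 :: real)"
    "188 / 100 \<le> ln (6587 / 1000 :: real)" "192 / 100 \<le> ln (6848 / 1000 :: real)"
  proof -
    have "ln (3 / 2) \<le> ln (1500 / 1000 :: real)" by simp
    moreover have "ln (3 / 2 :: real) = ln 3 - ln 2" by (simp add: ln_div)
    ultimately show "4 / 10 \<le> ln (1500 / 1000 :: real)" using lb by linarith
    have "ln (125 / 36) \<le> ln (3476 / 1000 :: real)" by simp
    moreover have "ln (125 / 36 :: real) = 3 * ln 5 - 2 * ln 2 - 2 * ln 3" using ln_5_smooth[of 0 0 3] ln_5_smooth[of 2 2 0] by (simp add: ln_div)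
    ultimately show "124 / 100 \<le> ln (3476 / 1000 :: real)" using lb by linarith
    have "ln (9 / 2) \<le> ln (4547 / 1000 :: real)" by simp
    moreover have "ln (9 / 2 :: real) = 2 * ln 3 - ln 2" using ln_5_smooth[of 0 2 0] by (simp add: ln_div)
    ultimately show "15 / 10 \<le> ln (4547 / 1000 :: real)" using lb by linarith
    have "ln (27 / 5) \<le> ln (5415 / 1000 :: real)" by simp
    moreover have "ln (27 / 5 :: real) = 3 * ln 3 - ln 5" using ln_5_smooth[of 0 3 0] by (simp add: ln_div)
    ultimately show "168 / 100 \<le> ln (5415 / 1000 :: real)" using lb by linarith
    have "ln (256 / 45) \<le> ln (5759 / 1000 :: real)" by simp
    moreover have "ln (256 / 45 :: real) = 8 * ln 2 - 2 * ln 3 - ln 5" using ln_5_smooth[of 8 0 0] ln_5_smooth[of 0 2 1] by (simp add: ln_div)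
    ultimately show "173 / 100 \<le> ln (5759 / 1000 :: real)" using lb by linarith
    have "ln (243 / 40) \<le> ln (6093 / 1000 :: real)" by simp
    moreover have "ln (243 / 40 :: real) = 5 * ln 3 - 3 * ln 2 - ln 5" using ln_5_smooth[of 0 5 0] ln_5_smooth[of 3 0 1] by (simp add: ln_div)
    ultimately show "18 / 10 \<le> ln (6093 / 1000 :: real)" using lb by linarith
    have "ln (6561 / 1000) \<le> ln (6587 / 1000 :: real)" by simp
    moreover have "ln (6561 / 1000 :: real) = 8 * ln 3 - 3 * ln 2 - 3 * ln 5" using ln_5_smooth[of 0 8 0] ln_5_smooth[of 3 0 3] by (simp add: ln_div)
    ultimately show "188 / 100 \<le> ln (6587 / 1000 :: real)" using lb by linarith
    have "ln (512 / 75) \<le> ln (6848 / 1000 :: real)" by simp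
    moreover have "ln (512 / 75 :: real) = 9 * ln 2 - ln 3 - 2 * ln 5" using ln_5_smooth[of 9 0 0] ln_5_smooth[of 0 1 2] by (simp add: ln_div)
    ultimately show "192 / 100 \<le> ln (6848 / 1000 :: real)" using lb by linarith
  qed
  have f: "v \<le> f k" if "d * k \<le> 1000 * nth_prime k" "k > 0" "v \<le> ln (real d / 1000)" "d > 0" for d k v
    using ln_nth_prime_minus_ln_ge[of d k v] that by (simp add: f_def)
  note t = nth_prime_lower_table
  have "0 \<le> (\<Sum>j\<in>{1..1}. f j)"
    using prime_ge_1_nat[OF prime_nth_prime[of 1]] by (simp add: f_def)
  hence s0: "0 \<le> (\<Sum>j\<in>{1..1}. f j)" .
  have "0 + (real 20 - real 1) * (4 / 10) \<le> (\<Sum>j\<in>{1..20}. f j)"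
    by (rule sum_atLeastAtMost_extend[OF _ s0]) (simp, rule f[of 1500], use t(1) v(1) in simp_all)
  hence s1: "76 / 10 \<le> (\<Sum>j\<in>{1..20}. f j)" by simp
  have "76 / 10 + (real 50 - real 20) * (124 / 100) \<le> (\<Sum>j\<in>{1..50}. f j)"
    by (rule sum_atLeastAtMost_extend[OF _ s1]) (simp, rule f[of 3476], use t(2) v(2) in simp_all)
  hence s2: "448 / 10 \<le> (\<Sum>j\<in>{1..50}. f j)" by simp
  have "448 / 10 + (real 100 - real 50) * (15 / 10) \<le> (\<Sum>j\<in>{1..100}. f j)"
    by (rule sum_atLeastAtMost_extend[OF _ s2]) (simp, rule f[of 4547], use t(3) v(3) in simp_all)
  hence s3: "1198 / 10 \<le> (\<Sum>j\<in>{1..100}. f j)" by simp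
  have "1198 / 10 + (real 150 - real 100) * (168 / 100) \<le> (\<Sum>j\<in>{1..150}. f j)"
    by (rule sum_atLeastAtMost_extend[OF _ s3]) (simp, rule f[of 5415], use t(4) v(4) in simp_all)
  hence s4: "2038 / 10 \<le> (\<Sum>j\<in>{1..150}. f j)" by simp
  have "2038 / 10 + (real 200 - real 150) * (173 / 100) \<le> (\<Sum>j\<in>{1..200}. f j)"
    by (rule sum_atLeastAtMost_extend[OF _ s4]) (simp, rule f[of 5759], use t(5) v(5) in simp_all)
  hence s5: "2903 / 10 \<le> (\<Sum>j\<in>{1..200}. f j)" by simp
  have "2903 / 10 + (real 300 - real 200) * (18 / 10) \<le> (\<Sum>j\<in>{1..300}. f j)"
    by (rule sum_atLeastAtMost_extend[OF _ s5]) (simp, rule f[of 6093], use t(6) v(6) in simp_all)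
  hence s6: "4703 / 10 \<le> (\<Sum>j\<in>{1..300}. f j)" by simp
  have "4703 / 10 + (real 400 - real 300) * (188 / 100) \<le> (\<Sum>j\<in>{1..400}. f j)"
    by (rule sum_atLeastAtMost_extend[OF _ s6]) (simp, rule f[of 6587], use t(7) v(7) in simp_all)
  hence s7: "6583 / 10 \<le> (\<Sum>j\<in>{1..400}. f j)" by simp
  have "6583 / 10 + (real 500 - real 400) * (192 / 100) \<le> (\<Sum>j\<in>{1..500}. f j)"
    by (rule sum_atLeastAtMost_extend[OF _ s7]) (simp, rule f[of 6848], use t(8) v(8) in simp_all)
  hence s8: "8503 / 10 \<le> (\<Sum>j\<in>{1..500}. f j)" by simp
  have sum: "(\<Sum>j\<in>{1..n}. f j) = (\<Sum>j\<in>{1..n}. ln (nth_prime j)) - ln (fact n)" for n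
    unfolding f_def sum_subtractf fact_prod by (simp, subst ln_prod) auto
  have stirling: "real n * ln n - n \<le> ln (fact n)" for n
  proof (cases "n \<ge> 1")
    case True
    hence "1 / (4 * real n) \<ge> 0" "ln (real n) \<ge> 0" by simp_all
    thus ?thesis using ln_fact_lower[OF True] by linarith
  qed (simp add: not_le)
  have "n * ln n - n + (\<Sum>j\<in>{1..n}. f j) \<le> (\<Sum>j\<in>{1..n}. ln (nth_prime j))" for n
    using sum[of n] stirling[of n] by linarith
  from this[of 500] s8 show ?thesis by simp
qed

subsection \<open>Growth of the primes\<close>

text \<open>A bootstrap. By Chebyshev's bound for \<open>psi\<close>, the hypothesis at k gives 6.9
  k <= 1.123 p for the next prime p, hence p >= 45/8 (k + 1) and ln p >= ln (k + 1) + 1.7. The left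
  side grows by at most ln (k + 1) + 0.7 + 1, so the constant 0.7 reproduces itself.\<close>

lemma sum_ln_nth_prime_ge:
  assumes "k \<ge> 500"
  shows "k * (ln k + 7 / 10) \<le> (\<Sum>j\<in>{1..k}. ln (nth_prime j))"
  using assms
proof (induction k rule: nat_induct_at_least)
  case base
  show ?case using sum_ln_nth_prime_500 by simp
next
  case (Suc k)
  define p where "p = nth_prime (Suc k)"
  define T where "T = (\<Sum>j\<in>{1..k}. ln (real (nth_prime j)))"
  have T: "k * (ln k + 7 / 10) \<le> T" using Suc by (simp add: T_def)
  have "3424 \<le> nth_prime 500" using nth_prime_lower_table(8)[of 500] by simp
  also have "\<dots> \<le> p" unfolding p_def using Suc by (intro nth_prime_mono) auto
  finally have p: "3424 \<le> p" .
  have "ln (500::real) = 2 * ln 2 + 3 * ln 5" using ln_5_smooth[of 2 0 3] by simp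
  hence "62 / 10 \<le> ln (500::real)" using ln_2_bounds ln_5_bounds by linarith
  also have "\<dots> \<le> ln k" using Suc by simp
  finally have "real k * (62 / 10 + 7 / 10) \<le> k * (ln k + 7 / 10)" by (intro mult_left_mono) auto
  also have "\<dots> \<le> T + ln p" using T ln_ge_zero[of p] p by linarith
  also have "\<dots> = theta p"
    unfolding p_def by (subst theta_nth_prime) (auto simp: T_def)
  also have "\<dots> \<le> psi p" by (rule theta_le_psi)
  also have "\<dots> \<le> 1123 / 1000 * p" using p by (rule psi_le)
  finally have "45 / 8 * real (Suc k) \<le> p" using Suc.hyps by simp
  hence "ln (45 / 8 * real (Suc k)) \<le> ln p" by (intro ln_mono) auto
  moreover have "ln (45 / 8 * real (Suc k)) = ln (45 / 8) + ln (Suc k)"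
    by (intro ln_mult_pos) auto
  moreover have "ln (45 / 8 :: real) = 2 * ln 3 + ln 5 - 3 * ln 2"
    using ln_5_smooth[of 0 2 1] ln_5_smooth[of 3 0 0] by (simp add: ln_div)
  ultimately have lnp: "17 / 10 + ln (Suc k) \<le> ln p"
    using ln_2_bounds ln_3_bounds ln_5_bounds by linarith
  have "ln (Suc k / k) \<le> Suc k / k - 1" using Suc by (intro ln_le_minus_one) auto
  hence "k * (ln (Suc k) - ln k) \<le> k * (Suc k / k - 1)"
    using Suc by (intro mult_left_mono) (auto simp: ln_div)
  also have "\<dots> = 1" using Suc by (simp add: field_simps)
  finally have "k * ln (Suc k) \<le> k * ln k + 1" by (simp add: algebra_simps)
  hence "Suc k * (ln (Suc k) + 7 / 10) \<le> k * (ln k + 7 / 10) + (17 / 10 + ln (Suc k))"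
    unfolding of_nat_Suc ring_distribs by linarith
  also have "\<dots> \<le> T + ln p" using T lnp by (rule add_mono)
  also have "\<dots> = (\<Sum>j\<in>{1..Suc k}. ln (nth_prime j))" by (simp add: T_def p_def)
  finally show ?case .
qed

lemma nth_prime_lower:
  assumes "k \<ge> 500"
  shows "k * (ln k + 7 / 10) \<le> 1123 / 1000 * nth_prime k"
proof -
  have "3424 \<le> nth_prime 500" using nth_prime_lower_table(8)[of 500] by simp
  also have "\<dots> \<le> nth_prime k" using assms by (intro nth_prime_mono) auto
  finally have "psi (nth_prime k) \<le> 1123 / 1000 * nth_prime k" by (rule psi_le)
  moreover have "k * (ln k + 7 / 10) \<le> theta (nth_prime k)"
    using sum_ln_nth_prime_ge[OF assms] assms by (subst theta_nth_prime) auto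
  ultimately show ?thesis using theta_le_psi[of "nth_prime k"] by linarith
qed

lemma nth_prime_Suc_bounds:
  assumes "n \<ge> 1000"
  defines "x \<equiv> real (nth_prime (n + 1))"
  shows "9212 / 10000 * x \<le> 10025 / 10000 * n * ln x"
    and "ln x \<le> (12 * ln n + 1888 / 100) / 11"
    and "ln n + 19 / 10 \<le> ln x"
proof -
  have "3424 \<le> nth_prime 500" using nth_prime_lower_table(8)[of 500] by simp
  also have "\<dots> \<le> nth_prime (n + 1)" using assms by (intro nth_prime_mono) auto
  finally have x: "x \<ge> 3424" by (simp add: x_def)
  have "9212 / 10000 * x \<le> (n + 1 + 3 / 2) * ln x"
    unfolding x_def using card_primes_ge[of "nth_prime (n + 1)"] x card_primes_le_nth_prime[of "n + 1"]
    by (simp add: x_def add.commute)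
  \<comment> \<open>\<open>n + 5/2 <= 1.0025 * n\<close> holds from n = 1000 on.\<close>
  also have "\<dots> \<le> (10025 / 10000 * n) * ln x"
    using assms x by (intro mult_right_mono) auto
  finally show 1: "9212 / 10000 * x \<le> 10025 / 10000 * n * ln x" .
  define X where "X = ln x"
  have X: "X > 0" using x by (simp add: X_def)
  have n: "real n > 0" using assms by simp
  have "0 \<le> n * X" using X n by simp
  hence "x \<le> 10883 / 10000 * n * X" using 1 unfolding X_def[symmetric] mult.assoc by linarith
  hence "ln x \<le> ln (10883 / 10000 * n * X)" using x by (intro ln_mono) auto
  also have "\<dots> = ln (10883 / 10000 * n) + ln X" using X n by (intro ln_mult_pos) auto
  also have "ln (10883 / 10000 * real n) = ln (10883 / 10000) + ln n" using n by (intro ln_mult_pos) auto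
  finally have "X \<le> ln (10883 / 10000) + ln n + ln X" by (simp add: X_def)
  moreover have "ln (10883 / 10000 :: real) \<le> 10883 / 10000 - 1" by (rule ln_le_minus_one) simp
  \<comment> \<open>The tangent of ln at 12 makes the bound for \<open>ln x\<close> linear in
    \<open>ln n\<close>. Its slope 12/11 is small enough to keep the limit of \<kappa> below
    1.348.\<close>
  moreover have "ln X = ln (X / 12) + ln 12" using X by (simp add: ln_div)
  moreover have "ln (X / 12) \<le> X / 12 - 1" using X by (intro ln_le_minus_one) auto
  moreover have "ln (12::real) = 2 * ln 2 + ln 3" using ln_5_smooth[of 2 1 0] by simp
  ultimately have "11 * X \<le> 12 * ln n + 1888 / 100"
    using ln_2_bounds ln_3_bounds by linarith
  thus "ln x \<le> (12 * ln n + 1888 / 100) / 11" by (simp add: X_def)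
  have "69 / 10 \<le> ln (1000::real)"
    using ln_5_smooth[of 3 0 3] ln_2_bounds ln_5_bounds by simp
  also have "\<dots> \<le> ln n" using assms by simp
  finally have "real n * (69 / 10 + 7 / 10) \<le> n * (ln n + 7 / 10)" by (intro mult_left_mono) auto
  also have "\<dots> \<le> 1123 / 1000 * nth_prime n" using assms by (intro nth_prime_lower) auto
  also have "real (nth_prime n) \<le> x"
    using assms nth_prime_mono[of n "n + 1"] by (simp add: x_def)
  finally have "27 / 4 * real n \<le> x" using n by simp
  hence "ln (27 / 4 * real n) \<le> ln x" using n by (intro ln_mono) auto
  moreover have "ln (27 / 4 * real n) = ln (27 / 4) + ln n" using n by (intro ln_mult_pos) auto
  moreover have "ln (27 / 4 :: real) = 3 * ln 3 - 2 * ln 2"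
    using ln_5_smooth[of 0 3 0] ln_5_smooth[of 2 0 0] by (simp add: ln_div)
  ultimately show "ln n + 19 / 10 \<le> ln x" using ln_2_bounds ln_3_bounds by linarith
qed

text \<open>By exp u >= 1 + u it is enough that 0.15 (H - t) >= 1, and 0.15 (7.6 - 0.7) = 1.035.
  With H = ln n + 0.7 and t = ln n - ln k the exponential is (k/n)^0.15 and the right side is ln k +
  0.7.\<close>

lemma exp_neg_tilt:
  fixes H t :: real
  assumes "H \<ge> 76 / 10" "0 \<le> t" "t \<le> 7 / 10"
  shows "H * exp (- (15 / 100 * t)) \<le> H - t"
proof -
  have u: "1 + 15 / 100 * t \<le> exp (15 / 100 * t)" by (rule exp_ge_add_one_self)
  have "t * (1 + 15 / 100 * t) \<le> t * (15 / 100 * H)" using assms by (intro mult_left_mono) auto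
  hence "H \<le> (H - t) * (1 + 15 / 100 * t)" by (simp add: algebra_simps)
  also have "\<dots> \<le> (H - t) * exp (15 / 100 * t)" using u assms by (intro mult_left_mono) auto
  finally have "H * exp (- (15 / 100 * t)) \<le> (H - t) * exp (15 / 100 * t) * exp (- (15 / 100 * t))"
    by (intro mult_right_mono) auto
  also have "\<dots> = H - t" by (simp add: mult.assoc flip: exp_add)
  finally show ?thesis .
qed

text \<open>
  The tilt exponent only has to be somewhat larger than $1/(\ln 1000 + 0.7)$. Without it, the
  loss from $\ln k < \ln n$ would push $\kappa$ too high for $n$ near 1000.
\<close>

lemma nth_prime_tilted_lower:
  fixes n k :: nat
  assumes "n \<ge> 1000" "n div 2 < k" "k \<le> n"
  shows "(ln n + 7 / 10) * k * (k / n) powr (15 / 100) \<le> 1123 / 1000 * nth_prime k"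
proof -
  define t where "t = ln n - ln k"
  have k: "k \<ge> 500" "real k > 0" using assms by auto
  have "real n \<le> 2 * real k" using assms by linarith
  hence "ln n \<le> ln (2 * real k)" using k assms by (intro ln_mono) auto
  hence "t \<le> 7 / 10" using ln_2_bounds k by (simp add: t_def ln_mult_pos)
  moreover have "t \<ge> 0" using assms k by (simp add: t_def)
  moreover have "69 / 10 \<le> ln (1000::real)"
    using ln_5_smooth[of 3 0 3] ln_2_bounds ln_5_bounds by simp
  moreover have "ln (1000::real) \<le> ln n" using assms by simp
  ultimately have tilt: "(ln n + 7 / 10) * exp (- (15 / 100 * t)) \<le> ln n + 7 / 10 - t"
    by (intro exp_neg_tilt) linarith+
  have "(k / n) powr (15 / 100) = exp (- (15 / 100 * t))"
  proof -
    have "ln (real k / real n) = - t" using k assms by (simp add: t_def ln_div)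
    thus ?thesis using k assms by (simp add: powr_def)
  qed
  hence "(ln n + 7 / 10) * k * (k / n) powr (15 / 100) = k * ((ln n + 7 / 10) * exp (- (15 / 100 * t)))"
    by simp
  also have "\<dots> \<le> k * (ln n + 7 / 10 - t)" using tilt by (intro mult_left_mono) auto
  also have "\<dots> = k * (ln k + 7 / 10)" by (simp add: t_def)
  also have "\<dots> \<le> 1123 / 1000 * nth_prime k" using k by (intro nth_prime_lower)
  finally show ?thesis .
qed

subsection \<open>Power sums and roots\<close>

lemma powr_Suc_diff_le:
  assumes "\<gamma> \<ge> 1"
  shows "real (Suc n) powr \<gamma> - real n powr \<gamma> \<le> \<gamma> * real (Suc n) powr (\<gamma> - 1)"
proof (cases "n = 0")
  case False
  have "\<exists>z. real n < z \<and> z < real (Suc n) \<and>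
      real (Suc n) powr \<gamma> - real n powr \<gamma> = (real (Suc n) - real n) * (\<gamma> * z powr (\<gamma> - 1))"
    using False by (intro MVT2) (auto intro!: derivative_eq_intros)
  then obtain z where z: "real n < z" "z < real (Suc n)"
    "real (Suc n) powr \<gamma> - real n powr \<gamma> = \<gamma> * z powr (\<gamma> - 1)" by auto
  have "z powr (\<gamma> - 1) \<le> real (Suc n) powr (\<gamma> - 1)"
    using z assms by (intro powr_mono2) auto
  thus ?thesis using z(3) assms by (simp add: mult_left_mono)
qed (use assms in simp)

lemma sum_powr_ge:
  assumes "\<beta> \<ge> 0" "m \<le> n"
  shows "(real n powr (\<beta> + 1) - real m powr (\<beta> + 1)) / (\<beta> + 1) \<le> (\<Sum>k\<in>{m<..n}. real k powr \<beta>)"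
  using assms(2)
proof (induction n rule: dec_induct)
  case (step n)
  have "{m<..Suc n} = insert (Suc n) {m<..n}" using step by auto
  hence "(\<Sum>k\<in>{m<..Suc n}. real k powr \<beta>) = real (Suc n) powr \<beta> + (\<Sum>k\<in>{m<..n}. real k powr \<beta>)"
    by simp
  moreover have "(real (Suc n) powr (\<beta> + 1) - real n powr (\<beta> + 1)) / (\<beta> + 1) \<le> real (Suc n) powr \<beta>"
    using powr_Suc_diff_le[of "\<beta> + 1" n] assms(1) by (simp add: divide_le_eq mult.commute)
  ultimately show ?case using step.IH by (simp add: diff_divide_distrib)
qed simp

text \<open>Only k > n/2 enters, so the bound on primes is required only where k is large. The
  discarded half costs the factor 1 - 2^-(\<beta>+1), which approaches 1 quickly as \<alpha>
  grows.\<close>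

lemma S_lower_bound:
  fixes \<alpha> \<epsilon> \<kappa> x :: real and n :: nat
  defines "\<beta> \<equiv> (1 + \<epsilon>) * \<alpha>"
  assumes "\<alpha> \<ge> 0" "\<epsilon> \<ge> 0" "\<kappa> > 0" "x > 0" "n > 0"
    and primes: "\<And>k. n div 2 < k \<Longrightarrow> k \<le> n \<Longrightarrow> x / \<kappa> * (k / n) powr (1 + \<epsilon>) \<le> nth_prime k"
  shows "x powr \<alpha> * n * (1 - 2 powr - (\<beta> + 1)) \<le> \<kappa> powr \<alpha> * (\<beta> + 1) * S \<alpha> n"
proof -
  let ?m = "n div 2"
  have \<beta>: "\<beta> \<ge> 0" using assms by (simp add: \<beta>_def)
  have half: "(n / 2) powr \<gamma> = n powr \<gamma> * 2 powr - \<gamma>" for \<gamma> :: real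
    by (simp add: powr_divide powr_minus_divide)
  have "real ?m powr (\<beta> + 1) \<le> (n / 2) powr (\<beta> + 1)"
    using \<beta> by (intro powr_mono2) auto
  hence "n powr (\<beta> + 1) * (1 - 2 powr - (\<beta> + 1)) \<le> n powr (\<beta> + 1) - real ?m powr (\<beta> + 1)"
    unfolding half right_diff_distrib mult_1_right by linarith
  hence "n powr (\<beta> + 1) * (1 - 2 powr - (\<beta> + 1)) / (\<beta> + 1)
      \<le> (n powr (\<beta> + 1) - real ?m powr (\<beta> + 1)) / (\<beta> + 1)"
    using \<beta> by (intro divide_right_mono) linarith+
  also have "\<dots> \<le> (\<Sum>k\<in>{?m<..n}. real k powr \<beta>)" using \<beta> by (intro sum_powr_ge) auto
  finally have sum: "n powr (\<beta> + 1) * (1 - 2 powr - (\<beta> + 1)) / (\<beta> + 1) \<le> (\<Sum>k\<in>{?m<..n}. real k powr \<beta>)" .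
  define C where "C = (x / \<kappa>) powr \<alpha> / n powr \<beta>"
  have "C \<ge> 0" by (simp add: C_def)
  have "x powr \<alpha> * n * (1 - 2 powr - (\<beta> + 1))
      = \<kappa> powr \<alpha> * (\<beta> + 1) * (C * (n powr (\<beta> + 1) * (1 - 2 powr - (\<beta> + 1)) / (\<beta> + 1)))"
    using assms \<beta> by (simp add: C_def powr_divide powr_add)
  also have "\<dots> \<le> \<kappa> powr \<alpha> * (\<beta> + 1) * (C * (\<Sum>k\<in>{?m<..n}. real k powr \<beta>))"
    using sum \<open>C \<ge> 0\<close> \<beta> by (intro mult_left_mono) auto
  also have "C * (\<Sum>k\<in>{?m<..n}. real k powr \<beta>) = (\<Sum>k\<in>{?m<..n}. (x / \<kappa> * (k / n) powr (1 + \<epsilon>)) powr \<alpha>)"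
    using assms by (auto simp: sum_distrib_left C_def \<beta>_def powr_mult powr_divide powr_powr intro!: sum.cong)
  also have "\<dots> \<le> (\<Sum>k\<in>{?m<..n}. real (nth_prime k) powr \<alpha>)"
    using assms by (intro sum_mono powr_mono2 primes) auto
  also have "\<dots> \<le> S \<alpha> n"
    unfolding S_def by (intro sum_mono2) auto
  finally show ?thesis using \<beta> by (simp add: mult_left_mono)
qed

lemma S_Suc: "S \<alpha> (n + 1) = S \<alpha> n + real (nth_prime (n + 1)) powr \<alpha>"
  by (simp add: S_def)

lemma S_gt:
  assumes "\<alpha> \<ge> 1" "n \<ge> 1"
  shows "real n < S \<alpha> n"
proof -
  have "1 < real (nth_prime k) powr \<alpha>" for k
    using prime_gt_1_nat[OF prime_nth_prime[of k]] assms by (intro gr_one_powr) auto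
  hence "(\<Sum>k\<in>{1..n}. 1) < S \<alpha> n"
    unfolding S_def using assms by (intro sum_strict_mono) auto
  thus ?thesis by simp
qed

lemma ln_20_le: "ln (20::real) \<le> 3"
  using ln_5_smooth[of 2 0 1] ln_2_bounds ln_5_bounds by simp

lemma root_less_root_iff_ln:
  assumes "a > 0" "b > 0" "m > 0" "n > 0" "ln a / m < ln b / n"
  shows "root m a < root n b"
proof -
  have "root m a = exp (ln a / m)" "root n b = exp (ln b / n)"
    using assms by (simp_all add: root_powr_inverse powr_def)
  thus ?thesis using assms by simp
qed

text \<open>
  The factor $1.05$ comes from $\ln r \le r/20 + 2$, which turns $r + \ln r \le 1 + \alpha \ln x$
  into a condition that is linear in $r = x^\alpha n / S_n^{(\alpha)}$.
\<close>

lemma roots_decrease: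
  fixes \<alpha> R :: real and n :: nat
  defines "x \<equiv> real (nth_prime (n + 1))"
  assumes "\<alpha> \<ge> 1" "n \<ge> 3" and R: "x powr \<alpha> * n \<le> R * S \<alpha> n" "1.05 * R \<le> \<alpha> * ln x - 1"
  shows "root n (S \<alpha> n / n) > root (n + 1) (S \<alpha> (n + 1) / real (n + 1))
     \<and> root n (S \<alpha> n) > root (n + 1) (S \<alpha> (n + 1))"
proof -
  define A where "A = S \<alpha> n / n"
  define A' where "A' = S \<alpha> (n + 1) / real (n + 1)"
  define r where "r = x powr \<alpha> / A"
  have n: "real n > 0" using assms by simp
  have A: "A > 1" using S_gt[of \<alpha> n] assms by (simp add: A_def)
  have S: "S \<alpha> n = n * A" using n by (simp add: A_def)
  have x: "x > 1" using prime_gt_1_nat[OF prime_nth_prime[of "n + 1"]] by (simp add: x_def)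
  have r: "r > 0" using A x by (simp add: r_def)
  have rR: "r \<le> R" using R(1) n A by (simp add: r_def S field_simps)
  have "ln r = ln (r / 20) + ln 20" using r by (simp add: ln_div)
  also have "ln (r / 20) \<le> r / 20 - 1" using r by (intro ln_le_minus_one) auto
  finally have "ln r \<le> r / 20 + 2" using ln_20_le by simp
  moreover have "ln A = \<alpha> * ln x - ln r" using A x by (simp add: r_def ln_div ln_powr)
  ultimately have rA: "r - 1 \<le> ln A" using rR R(2) by simp
  have lnA: "ln A > 0" using A by simp
  have "S \<alpha> (n + 1) = n * A + x powr \<alpha>" by (simp only: S_Suc S x_def)
  also have "\<dots> = A * (n + r)" using A by (simp add: r_def algebra_simps)
  finally have A': "A' = A * ((n + r) / (n + 1))" by (simp add: A'_def)
  have A'0: "A' > 0" using A A' r n by simp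
  have "ln ((n + r) / (n + 1)) \<le> (n + r) / (n + 1) - 1"
    using n r by (intro ln_le_minus_one) auto
  also have "\<dots> = (r - 1) / (n + 1)" using n by (simp add: field_simps)
  also have "\<dots> \<le> ln A / (n + 1)" using rA n by (intro divide_right_mono) auto
  finally have "ln ((n + r) / (n + 1)) \<le> ln A / (n + 1)" .
  moreover have "ln A' = ln A + ln ((n + r) / (n + 1))"
    unfolding A' using A r n by (intro ln_mult_pos) auto
  ultimately have "ln A' \<le> ln A + ln A / (n + 1)" by simp
  hence "n * ln A' \<le> n * (ln A + ln A / (n + 1))" using n by (intro mult_left_mono) auto
  also have "\<dots> = (n + 1) * ln A - ln A / (n + 1)" using n by (simp add: field_simps)
  \<comment> \<open>Strictness comes from here: the estimate r - 1 <= ln A was not strict, but ln A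
    / (n + 1) is left over.\<close>
  also have "\<dots> < (n + 1) * ln A" using lnA by simp
  finally have main: "n * ln A' < (n + 1) * ln A" .
  hence "ln A' / real (n + 1) < ln A / n" using n by (simp add: field_simps)
  hence 1: "root (n + 1) A' < root n A" using A A'0 n by (intro root_less_root_iff_ln) auto
  \<comment> \<open>The n-th root of n does not increase for n >= 3, because n ln(1 + 1/n) <= 1 <=
    ln 3. Multiplying by it carries the inequality for means over to sums.\<close>
  have "ln (real n + 1) - ln n \<le> 1 / n"
  proof -
    have "ln ((real n + 1) / n) \<le> (real n + 1) / n - 1" using n by (intro ln_le_minus_one) auto
    also have "\<dots> = 1 / n" using n by (simp add: field_simps)
    finally show ?thesis using n by (simp add: ln_div)
  qed
  hence "n * (ln (real n + 1) - ln n) \<le> n * (1 / n)" using n by (intro mult_left_mono) auto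
  also have "\<dots> \<le> ln 3" using n ln_3_bounds by simp
  also have "\<dots> \<le> ln n" using assms by simp
  finally have "n * ln (real n + 1) \<le> (n + 1) * ln n" by (simp add: algebra_simps)
  with main have "n * (ln (real n + 1) + ln A') < (n + 1) * (ln n + ln A)" by (simp add: algebra_simps)
  moreover have "S \<alpha> (n + 1) = real (n + 1) * A'" by (simp add: A'_def)
  moreover have "ln (real n * A) = ln n + ln A" "ln (real (n + 1) * A') = ln (real n + 1) + ln A'"
    using n A A'0 by (simp_all add: ln_mult add.commute)
  ultimately have "ln (S \<alpha> (n + 1)) / real (n + 1) < ln (S \<alpha> n) / n"
    using n by (simp add: S field_simps)
  hence "root (n + 1) (S \<alpha> (n + 1)) < root n (S \<alpha> n)"
    using n A A'0 S \<open>S \<alpha> (n + 1) = real (n + 1) * A'\<close> by (intro root_less_root_iff_ln) auto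
  with 1 show ?thesis by (simp add: A_def A'_def)
qed

text \<open>
  Reduces inequalities that have to hold for all $\alpha$ in an interval to its end points.
\<close>

lemma exponential_below_chord:
  fixes a b c p r \<alpha> \<kappa> :: real
  assumes "a \<le> \<alpha>" "\<alpha> \<le> b" "\<kappa> \<ge> 1" "c \<ge> 0"
    and "a \<ge> 0" "(c * a + 1) * \<kappa> powr a \<le> p * a + r" "(c * b + 1) * \<kappa> powr b \<le> p * b + r"
  shows "(c * \<alpha> + 1) * \<kappa> powr \<alpha> \<le> p * \<alpha> + r"
proof (cases "a = b")
  case False
  define t where "t = (\<alpha> - a) / (b - a)"
  have "(1 - t) * a + t * b = a + t * (b - a)" by (simp add: algebra_simps)
  also have "\<dots> = \<alpha>" using False by (simp add: t_def)
  finally have t: "0 \<le> t" "t \<le> 1" "\<alpha> = (1 - t) * a + t * b"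
    using assms False by (auto simp: t_def)
  define A B where "A = \<kappa> powr a" and "B = \<kappa> powr b"
  have AB: "A \<le> B" unfolding A_def B_def using assms by (intro powr_mono) auto
  have "exp ((1 - t) * (a * ln \<kappa>) + t * (b * ln \<kappa>)) \<le> (1 - t) * exp (a * ln \<kappa>) + t * exp (b * ln \<kappa>)"
    using convex_onD[OF exp_convex, of t "a * ln \<kappa>" "b * ln \<kappa>"] t by simp
  hence "\<kappa> powr \<alpha> \<le> (1 - t) * A + t * B"
    using assms by (simp add: powr_def A_def B_def t(3) algebra_simps)
  moreover have "c * \<alpha> + 1 \<ge> 0" using assms by simp
  ultimately have "(c * \<alpha> + 1) * \<kappa> powr \<alpha> \<le> (c * \<alpha> + 1) * ((1 - t) * A + t * B)"
    by (intro mult_left_mono)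
  \<comment> \<open>The product of the two chords lies below the chord of the products, since both
    factors increase; the difference is the last term.\<close>
  also have "\<dots> = (1 - t) * ((c * a + 1) * A) + t * ((c * b + 1) * B) - c * (t * (1 - t) * ((b - a) * (B - A)))"
    unfolding t(3) by (simp add: algebra_simps)
  also have "\<dots> \<le> (1 - t) * ((c * a + 1) * A) + t * ((c * b + 1) * B)"
    using t AB assms by simp
  also have "\<dots> \<le> (1 - t) * (p * a + r) + t * (p * b + r)"
    using t assms by (intro add_mono mult_left_mono) (auto simp: A_def B_def)
  also have "\<dots> = p * \<alpha> + r" unfolding t(3) by (simp add: algebra_simps)
  finally show ?thesis .
qed (use assms in auto)

text \<open>Puts the power sum estimate into \<open>roots_decrease\<close> with 1.05 = 21/20. The
  natural number m <= \<alpha> replaces the power 2^-(\<beta>+1) by a rational number.\<close>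

lemma roots_decrease_if_primes_above:
  fixes \<alpha> \<epsilon> \<kappa> :: real and n m :: nat
  defines "x \<equiv> real (nth_prime (n + 1))"
  assumes "\<alpha> \<ge> 1" "n \<ge> 3" "\<epsilon> \<ge> 0" "\<kappa> > 0" "m \<le> \<alpha>"
    and primes: "\<And>k. n div 2 < k \<Longrightarrow> k \<le> n \<Longrightarrow> x / \<kappa> * (k / n) powr (1 + \<epsilon>) \<le> nth_prime k"
    and ineq: "21 * (((1 + \<epsilon>) * \<alpha> + 1) * \<kappa> powr \<alpha>) \<le> 20 * ((1 - 1 / 2 ^ (m + 1)) * (\<alpha> * ln x - 1))"
  shows "root n (S \<alpha> n / n) > root (n + 1) (S \<alpha> (n + 1) / real (n + 1))
     \<and> root n (S \<alpha> n) > root (n + 1) (S \<alpha> (n + 1))"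
proof -
  define \<beta> where "\<beta> = (1 + \<epsilon>) * \<alpha>"
  define c where "c = 1 - 1 / (2::real) ^ (m + 1)"
  define R where "R = \<kappa> powr \<alpha> * (\<beta> + 1) / c"
  have "1 < (2::real) ^ (m + 1)" by (rule one_less_power) auto
  hence c: "c > 0" by (simp add: c_def divide_less_eq)
  have x: "x > 0" using prime_gt_0_nat[OF prime_nth_prime[of "n + 1"]] by (simp add: x_def)
  have "\<alpha> \<le> \<beta>" using assms by (simp add: \<beta>_def algebra_simps)
  hence "m \<le> \<beta>" using \<open>m \<le> \<alpha>\<close> by linarith
  hence "(2::real) powr (- (\<beta> + 1)) \<le> 2 powr (- real (m + 1))" by (intro powr_mono) auto
  also have "\<dots> = 1 / 2 ^ (m + 1)" by (simp only: powr_minus_divide powr_realpow zero_less_numeral)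
  finally have "c \<le> 1 - 2 powr - (\<beta> + 1)" by (simp add: c_def)
  hence "x powr \<alpha> * n * c \<le> x powr \<alpha> * n * (1 - 2 powr - (\<beta> + 1))"
    by (intro mult_left_mono) auto
  also have "\<dots> \<le> \<kappa> powr \<alpha> * (\<beta> + 1) * S \<alpha> n"
    unfolding \<beta>_def using assms x by (intro S_lower_bound) auto
  finally have "x powr \<alpha> * n \<le> R * S \<alpha> n" using c by (simp add: R_def field_simps)
  moreover have "1.05 * R \<le> \<alpha> * ln x - 1"
  proof -
    have "21 * (R * c) \<le> 20 * (c * (\<alpha> * ln x - 1))"
      using ineq c by (simp add: R_def \<beta>_def c_def mult.commute)
    hence "c * (21 * R) \<le> c * (20 * (\<alpha> * ln x - 1))" by (simp only: mult_ac)
    hence "21 * R \<le> 20 * (\<alpha> * ln x - 1)" using c by (simp only: mult_le_cancel_left_pos)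
    thus ?thesis by simp
  qed
  ultimately show ?thesis using assms by (intro roots_decrease) (auto simp: x_def)
qed

lemma roots_decrease_on_interval:
  fixes \<alpha> \<epsilon> \<kappa> a b X :: real and n m :: nat
  defines "x \<equiv> real (nth_prime (n + 1))"
  assumes "a \<ge> 1" "a \<le> \<alpha>" "\<alpha> \<le> b" "n \<ge> 3" "\<epsilon> \<ge> 0" "\<kappa> \<ge> 1" "m \<le> a" "X \<le> ln x"
    and primes: "\<And>k. n div 2 < k \<Longrightarrow> k \<le> n \<Longrightarrow> x / \<kappa> * (k / n) powr (1 + \<epsilon>) \<le> nth_prime k"
    and "21 * (((1 + \<epsilon>) * a + 1) * \<kappa> powr a) \<le> 20 * ((1 - 1 / 2 ^ (m + 1)) * (a * X - 1))"
    and "21 * (((1 + \<epsilon>) * b + 1) * \<kappa> powr b) \<le> 20 * ((1 - 1 / 2 ^ (m + 1)) * (b * X - 1))"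
  shows "root n (S \<alpha> n / n) > root (n + 1) (S \<alpha> (n + 1) / real (n + 1))
     \<and> root n (S \<alpha> n) > root (n + 1) (S \<alpha> (n + 1))"
proof -
  define c where "c = 1 - 1 / (2::real) ^ (m + 1)"
  have "1 < (2::real) ^ (m + 1)" by (rule one_less_power) auto
  hence c: "c > 0" by (simp add: c_def divide_less_eq)
  have ends: "((1 + \<epsilon>) * a + 1) * \<kappa> powr a \<le> 20 / 21 * (c * X) * a + - (20 / 21 * c)"
    "((1 + \<epsilon>) * b + 1) * \<kappa> powr b \<le> 20 / 21 * (c * X) * b + - (20 / 21 * c)"
    using assms(11,12) unfolding c_def[symmetric] by (simp_all add: algebra_simps)
  have "((1 + \<epsilon>) * \<alpha> + 1) * \<kappa> powr \<alpha> \<le> 20 / 21 * (c * X) * \<alpha> + - (20 / 21 * c)"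
    using assms by (intro exponential_below_chord[OF _ _ _ _ _ ends]) auto
  hence "21 * (((1 + \<epsilon>) * \<alpha> + 1) * \<kappa> powr \<alpha>) \<le> 20 * (c * (\<alpha> * X - 1))"
    by (simp add: algebra_simps)
  also have "\<dots> \<le> 20 * (c * (\<alpha> * ln x - 1))"
    using c assms by (intro mult_left_mono diff_right_mono) auto
  finally show ?thesis
    unfolding c_def x_def using assms
    by (intro roots_decrease_if_primes_above[where \<epsilon> = \<epsilon> and \<kappa> = \<kappa> and m = m]) (auto simp: x_def)
qed

text \<open>In this range proportional bounds p_k >= (d/1000) k and p_{n+1} <= (e/1000) n are sharp
  enough, so no tilt is used and \<kappa> = e/d.\<close>

lemma roots_decrease_small:
  fixes \<alpha> a b X :: real and n m d e :: nat
  assumes "a \<ge> 1" "a \<le> \<alpha>" "\<alpha> \<le> b" "n \<ge> 3" "m \<le> a" "0 < d" "d \<le> e"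
    and lower: "\<And>k. n div 2 < k \<Longrightarrow> k \<le> n \<Longrightarrow> d * k \<le> 1000 * nth_prime k"
    and upper: "1000 * nth_prime (n + 1) \<le> e * n"
    and "X \<le> ln (nth_prime (n + 1))"
    and "21 * ((a + 1) * (e / d) powr a) \<le> 20 * ((1 - 1 / 2 ^ (m + 1)) * (a * X - 1))"
    and "21 * ((b + 1) * (e / d) powr b) \<le> 20 * ((1 - 1 / 2 ^ (m + 1)) * (b * X - 1))"
  shows "root n (S \<alpha> n / n) > root (n + 1) (S \<alpha> (n + 1) / real (n + 1))
     \<and> root n (S \<alpha> n) > root (n + 1) (S \<alpha> (n + 1))"
proof (rule roots_decrease_on_interval[where \<epsilon> = 0 and \<kappa> = "e / d" and m = m and a = a and b = b and X = X])
  fix k assume k: "n div 2 < k" "k \<le> n"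
  have "real (1000 * nth_prime (n + 1)) \<le> real (e * n)" using upper by (subst of_nat_le_iff)
  hence x: "real (nth_prime (n + 1)) \<le> e * n / 1000" by simp
  have "real (d * k) \<le> real (1000 * nth_prime k)" using lower[OF k] by (subst of_nat_le_iff)
  hence p: "d * k / 1000 \<le> nth_prime k" by simp
  have "nth_prime (n + 1) / (e / d) * (k / n) powr (1 + 0) = nth_prime (n + 1) * (d * k / (e * n))"
    using k assms by simp
  also have "\<dots> \<le> e * n / 1000 * (d * k / (e * n))" using x by (intro mult_right_mono) auto
  also have "\<dots> = d * k / 1000" using k assms by simp
  finally show "nth_prime (n + 1) / (e / d) * (k / n) powr (1 + 0) \<le> nth_prime k" using p by linarith
qed (use assms in auto)

text \<open>At half-integral \<alpha>, \<kappa> = q^2 turns \<kappa>^\<alpha> into a natural power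
  of a rational number, which can be evaluated.\<close>

lemma powr_half_nat:
  fixes q :: real
  assumes "q > 0"
  shows "(q\<^sup>2) powr (real i / 2) = q ^ i"
proof -
  have "(q\<^sup>2) powr (real i / 2) = (q powr 2) powr (real i / 2)" using assms by simp
  also have "\<dots> = q powr (real i)" by (simp only: powr_powr) simp
  finally show ?thesis using assms by (simp add: powr_realpow)
qed

text \<open>1.2222 is 1.123 * 1.0025 / 0.9212 rounded up: the quotient of the constants in the lower
  bound for p_k and the upper bound for p_{n+1}. The assumption on \<kappa> compares the remaining
  factors, \<open>ln x\<close> and \<open>ln n + 0.7\<close>.\<close>

lemma nth_prime_tilted_ratio:
  fixes \<kappa> :: real and n k :: nat
  defines "x \<equiv> real (nth_prime (n + 1))"
  assumes n: "n \<ge> 1000" and k: "n div 2 < k" "k \<le> n"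
    and \<kappa>: "\<kappa> > 0" "12222 / 10000 * (12 * ln n + 1888 / 100) \<le> 11 * \<kappa> * (ln n + 7 / 10)"
  shows "x / \<kappa> * (k / n) powr (1 + 15 / 100) \<le> nth_prime k"
proof -
  define w where "w = (k / n) powr (15 / 100)"
  have w: "w \<ge> 0" by (simp add: w_def)
  have "1123 / 1000 * x \<le> n * (12222 / 10000 * ln x)"
  proof -
    have "0 \<le> n * ln x"
      using prime_ge_1_nat[OF prime_nth_prime[of "n + 1"]] by (simp add: x_def)
    thus ?thesis
      using nth_prime_Suc_bounds(1)[OF n] unfolding x_def[symmetric] by (simp add: algebra_simps)
  qed
  also have "12222 / 10000 * ln x \<le> \<kappa> * (ln n + 7 / 10)"
    using nth_prime_Suc_bounds(2)[OF n] \<kappa> unfolding x_def[symmetric] by simp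
  finally have "1123 / 1000 * x \<le> n * (\<kappa> * (ln n + 7 / 10))" by (simp add: mult_left_mono)
  hence "1123 / 1000 * x * (k * w / (n * \<kappa>)) \<le> n * (\<kappa> * (ln n + 7 / 10)) * (k * w / (n * \<kappa>))"
    using w \<kappa> by (intro mult_right_mono) auto
  also have "\<dots> = (ln n + 7 / 10) * k * w" using n \<kappa> by (simp add: field_simps)
  also have "\<dots> \<le> 1123 / 1000 * nth_prime k"
    unfolding w_def using n k by (rule nth_prime_tilted_lower)
  finally have "1123 / 1000 * (x * (k * w / (n * \<kappa>))) \<le> 1123 / 1000 * nth_prime k"
    by (simp only: mult.assoc)
  hence "x * (k * w / (n * \<kappa>)) \<le> nth_prime k"
    by (subst (asm) mult_le_cancel_left_pos) auto
  also have "x * (k * w / (n * \<kappa>)) = x / \<kappa> * (k / n) powr (1 + 15 / 100)"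
    unfolding w_def powr_add using n k by simp
  finally show ?thesis .
qed

text \<open>The condition on \<kappa> = q^2 is linear in \<open>ln n\<close>. It therefore holds for
  all \<open>ln n >= L\<close> once it holds at \<open>L\<close> and the slopes compare, which are
  the two assumptions on \<open>q\<close> alone and \<open>L\<close>.\<close>

lemma roots_decrease_large:
  fixes \<alpha> q L :: real and n i j :: nat
  assumes "n \<ge> 1000" "i \<ge> 2" "i / 2 \<le> \<alpha>" "\<alpha> \<le> j / 2" "q \<ge> 1" "L \<ge> 0" "L \<le> ln n"
    and "12222 / 10000 * (12 * L + 1888 / 100) \<le> 11 * q\<^sup>2 * (L + 7 / 10)"
    and "12222 / 10000 * 12 \<le> 11 * q\<^sup>2"
    and "21 * ((115 / 100 * (i / 2) + 1) * q ^ i) \<le> 20 * ((1 - 1 / 2 ^ (i div 2 + 1)) * (i / 2 * (L + 19 / 10) - 1))"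
    and "21 * ((115 / 100 * (j / 2) + 1) * q ^ j) \<le> 20 * ((1 - 1 / 2 ^ (i div 2 + 1)) * (j / 2 * (L + 19 / 10) - 1))"
  shows "root n (S \<alpha> n / n) > root (n + 1) (S \<alpha> (n + 1) / real (n + 1))
     \<and> root n (S \<alpha> n) > root (n + 1) (S \<alpha> (n + 1))"
proof -
  have "12222 / 10000 * 12 * (ln n - L) \<le> 11 * q\<^sup>2 * (ln n - L)"
    using assms by (intro mult_right_mono) auto
  moreover have "12222 / 10000 * (12 * ln n + 1888 / 100)
      = 12222 / 10000 * (12 * L + 1888 / 100) + 12222 / 10000 * 12 * (ln n - L)"
    by (simp add: field_simps)
  moreover have "11 * q\<^sup>2 * (ln n + 7 / 10) = 11 * q\<^sup>2 * (L + 7 / 10) + 11 * q\<^sup>2 * (ln n - L)"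
    by (simp add: algebra_simps)
  ultimately have "12222 / 10000 * (12 * ln n + 1888 / 100) \<le> 11 * q\<^sup>2 * (ln n + 7 / 10)"
    using assms(8) by linarith
  hence primes: "nth_prime (n + 1) / q\<^sup>2 * (k / n) powr (1 + 15 / 100) \<le> nth_prime k"
    if "n div 2 < k" "k \<le> n" for k
    using assms that by (intro nth_prime_tilted_ratio) auto
  have q: "(q\<^sup>2) powr (real i / 2) = q ^ i" "(q\<^sup>2) powr (real j / 2) = q ^ j"
    using assms by (intro powr_half_nat; simp)+
  have X: "L + 19 / 10 \<le> ln (nth_prime (n + 1))"
    using nth_prime_Suc_bounds(3)[OF assms(1)] assms by simp
  have "real (i div 2) \<le> real i / 2" by linarith
  moreover have "1 \<le> q\<^sup>2" using assms by simp
  ultimately show ?thesis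
    using assms X primes
    by (intro roots_decrease_on_interval[of "i / 2" \<alpha> "j / 2" n "15 / 100" "q\<^sup>2" "i div 2" "L + 19 / 10"])
       (simp_all only: q, simp_all)
qed

text \<open>From ln n = 113 on, \<kappa> = 1.16^2 = 1.3456 < 1.348 is admissible. Then
  \<kappa>^\<alpha> <= z = 1.348^\<alpha>, and both sides are compared with \<alpha> z: at most 26
  on the left, nearly 40 on the right.\<close>

lemma roots_decrease_huge:
  fixes \<alpha> :: real and n :: nat
  assumes n: "n \<ge> 1000" and \<alpha>: "\<alpha> \<ge> 27 / 2" and L: "2 * 1.348 powr \<alpha> + 1 \<le> ln n" "113 \<le> ln n"
  shows "root n (S \<alpha> n / n) > root (n + 1) (S \<alpha> (n + 1) / real (n + 1))
     \<and> root n (S \<alpha> n) > root (n + 1) (S \<alpha> (n + 1))"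
proof (rule roots_decrease_if_primes_above[where \<epsilon> = "15 / 100" and \<kappa> = "13456 / 10000" and m = 13])
  define z where "z = 1.348 powr \<alpha>"
  have z: "z \<ge> 0" by (simp add: z_def)
  have "21 * ((1 + 15 / 100) * \<alpha> + 1) \<le> 26 * \<alpha>" using \<alpha> by simp
  hence 26: "21 * ((1 + 15 / 100) * \<alpha> + 1) * z \<le> 26 * \<alpha> * z" using z by (rule mult_right_mono)
  have "(13456 / 10000) powr \<alpha> \<le> z"
    unfolding z_def using \<alpha> by (intro powr_mono2) auto
  hence "21 * (((1 + 15 / 100) * \<alpha> + 1) * (13456 / 10000) powr \<alpha>) \<le> 21 * (((1 + 15 / 100) * \<alpha> + 1) * z)"
    using \<alpha> by (intro mult_left_mono) auto
  also have "\<dots> \<le> 26 * \<alpha> * z"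
    using 26 by (simp only: mult.assoc)
  also have "\<dots> \<le> 20 * ((1 - 1 / 2 ^ (13 + 1)) * (\<alpha> * (2 * z)))"
    using \<alpha> z by simp
  \<comment> \<open>The + 1 in the exponent of the hypothesis pays for the - 1, as \<alpha> >=
    1.\<close>
  also have "\<dots> \<le> 20 * ((1 - 1 / 2 ^ (13 + 1)) * (\<alpha> * (2 * z + 1) - 1))"
    using \<alpha> by (intro mult_left_mono) (auto simp: algebra_simps)
  also have "\<dots> \<le> 20 * ((1 - 1 / 2 ^ (13 + 1)) * (\<alpha> * ln (nth_prime (n + 1)) - 1))"
    using \<alpha> L(1) nth_prime_Suc_bounds(3)[OF n]
    by (intro mult_left_mono diff_right_mono) (auto simp: z_def)
  finally show "21 * (((1 + 15 / 100) * \<alpha> + 1) * (13456 / 10000) powr \<alpha>)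
      \<le> 20 * ((1 - 1 / 2 ^ (13 + 1)) * (\<alpha> * ln (nth_prime (n + 1)) - 1))" .
  show "nth_prime (n + 1) / (13456 / 10000) * (k / n) powr (1 + 15 / 100) \<le> nth_prime k"
    if "n div 2 < k" "k \<le> n" for k
    using n that L(2) by (intro nth_prime_tilted_ratio) auto
qed (use n \<alpha> in auto)

theorem theorem2p3:
  fixes \<alpha> :: real and n :: nat
  assumes "\<alpha> \<ge> 1"
    and "real n \<ge> max 100 (exp (2 * 1.348 powr \<alpha> + 1))"
  shows "root n (S \<alpha> n / real n) > root (n + 1) (S \<alpha> (n + 1) / real (n + 1))
     \<and> root n (S \<alpha> n) > root (n + 1) (S \<alpha> (n + 1))"
proof -
  have n100: "n \<ge> 100" using assms(2) by simp
  have "ln (exp (2 * 1.348 powr \<alpha> + 1)) \<le> ln n"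
    using assms(2) by (intro ln_mono) auto
  hence L: "2 * 1.348 powr \<alpha> + 1 \<le> ln n" by simp
  \<comment> \<open>1.161 is the square root of 1.348 rounded down.\<close>
  have pow: "(1161 / 1000) ^ i \<le> 1.348 powr \<alpha>" if "real i / 2 \<le> \<alpha>" for i
  proof -
    have "(1161 / 1000 :: real) ^ i = ((1161 / 1000)\<^sup>2) powr (real i / 2)"
      by (simp only: powr_half_nat)
    also have "\<dots> \<le> 1.348 powr (real i / 2)" by (intro powr_mono2) (auto simp: power2_eq_square)
    also have "\<dots> \<le> 1.348 powr \<alpha>" using that by (intro powr_mono) auto
    finally show ?thesis .
  qed
  consider "n < 300" | "300 \<le> n" "n < 1000" | "n \<ge> 1000" by linarith
  thus ?thesis
  proof cases
    case 1
    have "ln n \<le> ln 300" using 1 n100 by simp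
    also have "ln (300::real) = 2 * ln 2 + ln 3 + 2 * ln 5" using ln_5_smooth[of 2 1 2] by simp
    finally have "ln n \<le> 571 / 100" using ln_2_bounds ln_3_bounds ln_5_bounds by linarith
    \<comment> \<open>\<alpha> > 3 would force ln n >= 2 * 1.161^6 + 1 > 5.71. The bound \<alpha> <=
      4 for n < 1000 arises in the same way from 1.161^8.\<close>
    hence \<alpha>: "\<alpha> \<le> 3" using pow[of 6] L by (cases "\<alpha> \<le> 3") (auto simp: power_divide)
    have "546 \<le> nth_prime 101" using nth_prime_lower_table(4)[of 101] by simp
    also have "\<dots> \<le> nth_prime (n + 1)" using n100 by (intro nth_prime_mono) auto
    finally have "ln 540 \<le> ln (nth_prime (n + 1))" by (intro ln_mono) auto
    moreover have "ln (540::real) = 2 * ln 2 + 3 * ln 3 + ln 5" using ln_5_smooth[of 2 3 1] by simp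
    ultimately have X: "629 / 100 \<le> ln (nth_prime (n + 1))"
      using ln_2_bounds ln_3_bounds ln_5_bounds by linarith
    show ?thesis
    proof (rule roots_decrease_small[where a = 1 and b = 3 and m = 1 and d = 4547 and e = 6650, OF _ _ _ _ _ _ _ _ _ X])
      show "1000 * nth_prime (n + 1) \<le> 6650 * n"
        using nth_prime_le_6650[of "n + 1"] 1 n100 by simp
      show "4547 * k \<le> 1000 * nth_prime k" if "n div 2 < k" "k \<le> n" for k
        using that 1 n100 by (intro nth_prime_ge_4547) auto
    qed (use assms(1) \<alpha> n100 in \<open>auto simp: power_divide\<close>)
  next
    case 2
    have "ln n \<le> ln 1000" using 2 by simp
    also have "ln (1000::real) = 3 * ln 2 + 3 * ln 5" using ln_5_smooth[of 3 0 3] by simp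
    finally have "ln n \<le> 691 / 100" using ln_2_bounds ln_5_bounds by linarith
    hence \<alpha>: "\<alpha> \<le> 4" using pow[of 8] L by (cases "\<alpha> \<le> 4") (auto simp: power_divide)
    have "1982 \<le> nth_prime 301" using nth_prime_lower_table(7)[of 301] by simp
    also have "\<dots> \<le> nth_prime (n + 1)" using 2 by (intro nth_prime_mono) auto
    finally have "ln 1944 \<le> ln (nth_prime (n + 1))" by (intro ln_mono) auto
    moreover have "ln (1944::real) = 3 * ln 2 + 5 * ln 3" using ln_5_smooth[of 3 5 0] by simp
    ultimately have X: "757 / 100 \<le> ln (nth_prime (n + 1))"
      using ln_2_bounds ln_3_bounds by linarith
    show ?thesis
    proof (rule roots_decrease_small[where a = 1 and b = 4 and m = 1 and d = 5759 and e = 7940, OF _ _ _ _ _ _ _ _ _ X])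
      show "1000 * nth_prime (n + 1) \<le> 7940 * n"
        using nth_prime_le_7940[of "n + 1"] 2 by simp
      show "5759 * k \<le> 1000 * nth_prime k" if "n div 2 < k" "k \<le> n" for k
        using that 2 by (intro nth_prime_ge_5759) auto
    qed (use assms(1) \<alpha> 2 in \<open>auto simp: power_divide\<close>)
  next
    case 3
    have "ln 1000 \<le> ln n" using 3 by simp
    moreover have "ln (1000::real) = 3 * ln 2 + 3 * ln 5" using ln_5_smooth[of 3 0 3] by simp
    ultimately have ln_n: "6907 / 1000 \<le> ln n" using ln_2_bounds ln_5_bounds by linarith
    txt \<open>
      For $\alpha \ge i/2$ we have $1.348^\alpha \ge 1.161^i$, which gives the lower bound $L$ for $\ln n$;
      then $q$ is the smallest multiple of $1/1000$ for which $\kappa = q^2$ is admissible.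
    \<close>
    note large = roots_decrease_large[OF 3, of _ \<alpha>]
    consider "\<alpha> \<le> 7 / 2"
      | "7 / 2 \<le> \<alpha>" "\<alpha> \<le> 8 / 2"
      | "8 / 2 \<le> \<alpha>" "\<alpha> \<le> 9 / 2"
      | "9 / 2 \<le> \<alpha>" "\<alpha> \<le> 10 / 2"
      | "10 / 2 \<le> \<alpha>" "\<alpha> \<le> 11 / 2"
      | "11 / 2 \<le> \<alpha>" "\<alpha> \<le> 12 / 2"
      | "12 / 2 \<le> \<alpha>" "\<alpha> \<le> 13 / 2"
      | "13 / 2 \<le> \<alpha>" "\<alpha> \<le> 14 / 2"
      | "14 / 2 \<le> \<alpha>" "\<alpha> \<le> 15 / 2"
      | "15 / 2 \<le> \<alpha>" "\<alpha> \<le> 16 / 2"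
      | "16 / 2 \<le> \<alpha>" "\<alpha> \<le> 18 / 2"
      | "18 / 2 \<le> \<alpha>" "\<alpha> \<le> 20 / 2"
      | "20 / 2 \<le> \<alpha>" "\<alpha> \<le> 22 / 2"
      | "22 / 2 \<le> \<alpha>" "\<alpha> \<le> 24 / 2"
      | "24 / 2 \<le> \<alpha>" "\<alpha> \<le> 27 / 2"
      | "27 / 2 \<le> \<alpha>"
      using linear[of \<alpha> "7 / 2"] linear[of \<alpha> "8 / 2"] linear[of \<alpha> "9 / 2"] linear[of \<alpha> "10 / 2"] linear[of \<alpha> "11 / 2"] linear[of \<alpha> "12 / 2"] linear[of \<alpha> "13 / 2"] linear[of \<alpha> "14 / 2"] linear[of \<alpha> "15 / 2"] linear[of \<alpha> "16 / 2"] linear[of \<alpha> "18 / 2"] linear[of \<alpha> "20 / 2"] linear[of \<alpha> "22 / 2"] linear[of \<alpha> "24 / 2"] linear[of \<alpha> "27 / 2"] by blast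
    thus ?thesis
    proof cases
      \<comment> \<open>In this case and the next, L is the bound for ln 1000, since 2 * 1.161^7 + 1
        < 6.907. The cut at 7/2 changes the factor 1 - 1/2^(i div 2 + 1) from 3/4 to 15/16; with 3/4
        the inequality would fail at \<alpha> = 4.\<close>
      case 1
      with ln_n assms(1) show ?thesis
        by (intro large[where i = 2 and j = 7 and q = "1220 / 1000" and L = "6907 / 1000"]) (simp_all add: power_divide)
    next
      case 2
      with ln_n show ?thesis
        by (intro large[where i = 7 and j = 8 and q = "1220 / 1000" and L = "6907 / 1000"]) (simp_all add: power_divide)
    next
      case 3
      with pow[of 8] L have "7600 / 1000 \<le> ln n" by (simp add: power_divide)
      with 3 show ?thesis
        by (intro large[where i = 8 and j = 9 and q = "1214 / 1000" and L = "7600 / 1000"]) (simp_all add: power_divide)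
    next
      case 4
      with pow[of 9] L have "8660 / 1000 \<le> ln n" by (simp add: power_divide)
      with 4 show ?thesis
        by (intro large[where i = 9 and j = 10 and q = "1208 / 1000" and L = "8660 / 1000"]) (simp_all add: power_divide)
    next
      case 5
      with pow[of 10] L have "9890 / 1000 \<le> ln n" by (simp add: power_divide)
      with 5 show ?thesis
        by (intro large[where i = 10 and j = 11 and q = "1202 / 1000" and L = "9890 / 1000"]) (simp_all add: power_divide)
    next
      case 6
      with pow[of 11] L have "11330 / 1000 \<le> ln n" by (simp add: power_divide)
      with 6 show ?thesis
        by (intro large[where i = 11 and j = 12 and q = "1196 / 1000" and L = "11330 / 1000"]) (simp_all add: power_divide)
    next
      case 7
      with pow[of 12] L have "12990 / 1000 \<le> ln n" by (simp add: power_divide)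
      with 7 show ?thesis
        by (intro large[where i = 12 and j = 13 and q = "1191 / 1000" and L = "12990 / 1000"]) (simp_all add: power_divide)
    next
      case 8
      with pow[of 13] L have "14920 / 1000 \<le> ln n" by (simp add: power_divide)
      with 8 show ?thesis
        by (intro large[where i = 13 and j = 14 and q = "1187 / 1000" and L = "14920 / 1000"]) (simp_all add: power_divide)
    next
      case 9
      with pow[of 14] L have "17160 / 1000 \<le> ln n" by (simp add: power_divide)
      with 9 show ?thesis
        by (intro large[where i = 14 and j = 15 and q = "1183 / 1000" and L = "17160 / 1000"]) (simp_all add: power_divide)
    next
      case 10
      with pow[of 15] L have "19770 / 1000 \<le> ln n" by (simp add: power_divide)
      with 10 show ?thesis
        by (intro large[where i = 15 and j = 16 and q = "1180 / 1000" and L = "19770 / 1000"]) (simp_all add: power_divide)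
    next
      case 11
      with pow[of 16] L have "22790 / 1000 \<le> ln n" by (simp add: power_divide)
      with 11 show ?thesis
        by (intro large[where i = 16 and j = 18 and q = "1176 / 1000" and L = "22790 / 1000"]) (simp_all add: power_divide)
    next
      case 12
      with pow[of 18] L have "30370 / 1000 \<le> ln n" by (simp add: power_divide)
      with 12 show ?thesis
        by (intro large[where i = 18 and j = 20 and q = "1171 / 1000" and L = "30370 / 1000"]) (simp_all add: power_divide)
    next
      case 13
      with pow[of 20] L have "40590 / 1000 \<le> ln n" by (simp add: power_divide)
      with 13 show ?thesis
        by (intro large[where i = 20 and j = 22 and q = "1167 / 1000" and L = "40590 / 1000"]) (simp_all add: power_divide)
    next
      case 14
      with pow[of 22] L have "54370 / 1000 \<le> ln n" by (simp add: power_divide)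
      with 14 show ?thesis
        by (intro large[where i = 22 and j = 24 and q = "1164 / 1000" and L = "54370 / 1000"]) (simp_all add: power_divide)
    next
      case 15
      with pow[of 24] L have "72940 / 1000 \<le> ln n" by (simp add: power_divide)
      with 15 show ?thesis
        by (intro large[where i = 24 and j = 27 and q = "1162 / 1000" and L = "72940 / 1000"]) (simp_all add: power_divide)
    next
      case 16
      have "113 \<le> ln n" using pow[of 27] L 16 by (simp add: power_divide)
      thus ?thesis using 3 16 L by (intro roots_decrease_huge) auto
    qed
  qed
qed

end
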